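(* Fix an integer $k\ge1$. Let $q\in[1,k]$ and $j\in[1,q]$ be integers with $\gcd(j,q)=1$, and let $f,m,M,s,t,\eta,c$ be as defined in the context. Then for each $w\in[1,f]$, $c(0)\to c(1)\to\cdots\to c(q)=c(0)$ is a cycle of $G(\eta(q,j),k)$, and these $f$ cycles (for $w=1,\dots,f$) are distinct cycles of length $q$; consequently $N(\eta(q,j),k)=f$ and $\eta(q,j)$ is a local peak. Moreover, the local peaks are exactly the integers $\eta(q,j)$ with $1\le q\le k$, $1\le j\le q$, $\gcd(j,q)=1$; i.e. the set of points $(n,N(n,k))$ with $n$ a local peak is exactly $\{(\eta(q,j),\lfloor k/q\rfloor): 1\le q\le k,\ 1\le j\le q,\ \gcd(j,q)=1\}$.
   Context: For integers $\ell$ and $p\ge1$, $(\ell)_p$ (also $\ell_p$) denotes the least nonnegative residue of $\ell$ modulo $p$. $G(n,k)$ is the directed graph on vertices $0,\dots,k$ with exactly the $k$ edges $(i+n-2)_{k+1}\to(i+n-1)_k$, $1\le i\le k$ (a loop $a\to a$ counts as a cycle of length $1$). For $n>k$, $N(n,k)$ is the nullity of the $n\times n$ skew-symmetric Toeplitz matrix $A(n,k)$ whose first $k$ superdiagonals are all $1$ and remaining superdiagonals all $0$; this nullity depends only on $n \bmod (k^2+k)$, and $N(n,k)$ is defined for every integer $n$ as $N(n',k)$ for any $n'>k$ with $n'\equiv n\pmod{k^2+k}$. An integer $n$ with $0<n<k^2+k$ is a local peak if $N(n-1,k)<N(n,k)$ and $N(n+1,k)<N(n,k)$. Notation: $f=\lfloor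 k/q\rfloor$, $m=k-fq$, $M=m+1$; $s(q,j)=|\{a\in[1,m]:(aj)_q\le(Mj)_q\}|$; for $r\in[1,q-1]$, $t(r,q,j)=|\{a\in[0,m]:(aj)_q<(rj)_q\}|$; $\eta(q,j)=k\lfloor (k+1)j/q\rfloor-k+(Mj)_q f+s(q,j)$; for $w\in[1,f]$, $c(r)=-1-w+(rj)_q f+t(r,q,j)$ for $1\le r\le q-1$ and $c(0)=c(q)=k-w$. *)

theory Defs
  imports Main "Jordan_Normal_Form.Matrix_Kernel"
begin

definition G_verts :: "int \<Rightarrow> int set" where
  "G_verts k = {0..k}"

definition G_edges :: "int \<Rightarrow> int \<Rightarrow> (int \<times> int) set" where
  "G_edges n k = {((i + n - 2) mod (k + 1), (i + n - 1) mod k) | i. 1 \<le> i \<and> i \<le> k}"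

definition is_cycle :: "(int \<times> int) set \<Rightarrow> (int \<Rightarrow> int) \<Rightarrow> int \<Rightarrow> bool" where
  "is_cycle E c len \<longleftrightarrow> 1 \<le> len \<and> c len = c 0 \<and>
     (\<forall>r \<in> {0..<len}. (c r, c (r + 1)) \<in> E) \<and> inj_on c {0..<len}"

definition cycle_verts :: "(int \<Rightarrow> int) \<Rightarrow> int \<Rightarrow> int set" where
  "cycle_verts c len = c ` {0..<len}"

definition A_mat :: "nat \<Rightarrow> nat \<Rightarrow> real mat" where
  "A_mat n k = mat n n (\<lambda>(a, b).
      if b > a \<and> b - a \<le> k then 1
      else if a > b \<and> a - b \<le> k then -1 else 0)"

definition nullity :: "nat \<Rightarrow> nat \<Rightarrow> nat" where
  "nullity n k = kernel_dim (A_mat n k)"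

text \<open>N(n,k) for every integer n, via the representative n' = (n mod (k^2+k)) + (k^2+k) > k.\<close>
definition N :: "int \<Rightarrow> int \<Rightarrow> nat" where
  "N n k = nullity (nat (n mod (k^2 + k) + (k^2 + k))) (nat k)"

definition local_peak :: "int \<Rightarrow> int \<Rightarrow> bool" where
  "local_peak n k \<longleftrightarrow> 0 < n \<and> n < k^2 + k \<and> N (n - 1) k < N n k \<and> N (n + 1) k < N n k"

definition fq :: "int \<Rightarrow> int \<Rightarrow> int" where "fq k q = k div q"
definition mq :: "int \<Rightarrow> int \<Rightarrow> int" where "mq k q = k - fq k q * q"
definition Mq :: "int \<Rightarrow> int \<Rightarrow> int" where "Mq k q = mq k q + 1"

definition s_fun :: "int \<Rightarrow> int \<Rightarrow> int \<Rightarrow> int" where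
  "s_fun k q j = int (card {a \<in> {1..mq k q}. (a * j) mod q \<le> (Mq k q * j) mod q})"

definition t_fun :: "int \<Rightarrow> int \<Rightarrow> int \<Rightarrow> int \<Rightarrow> int" where
  "t_fun k r q j = int (card {a \<in> {0..mq k q}. (a * j) mod q < (r * j) mod q})"

definition eta :: "int \<Rightarrow> int \<Rightarrow> int \<Rightarrow> int" where
  "eta k q j = k * (((k + 1) * j) div q) - k + ((Mq k q * j) mod q) * fq k q + s_fun k q j"

definition c_fun :: "int \<Rightarrow> int \<Rightarrow> int \<Rightarrow> int \<Rightarrow> int \<Rightarrow> int" where
  "c_fun k q j w r = (if r = 0 \<or> r = q then k - w
      else -1 - w + ((r * j) mod q) * fq k q + t_fun k r q j)"

end

theory Submission
  imports Defs
begin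

text \<open>
  A kernel vector of \<open>A(n,k)\<close> is determined by its first \<open>k\<close> partial sums, regarded as weights of
  the vertices \<open>0, \<dots>, k - 1\<close> of \<open>G(n,k)\<close>, and the kernel consists of the weights that are constant
  along edges once the vertex \<open>k\<close> is given weight \<open>0\<close>. So the nullity is the number of components of
  \<open>G(n,k)\<close> other than that of \<open>k\<close>.

  For \<open>n = \<eta>(q,j)\<close> the graph acts like the rotation by \<open>j\<close> on \<open>q\<close> arcs: it consists of a path with
  \<open>m + 1\<close> vertices and \<open>f\<close> cycles of length \<open>q\<close>. Raising \<open>n\<close>
by one moves a single edge and splices
  one of the cycles into the path, and a reflection of the graph exchanges raising and lowering \<open>n\<close>.
  Hence \<open>N(\<eta>(q,j) + d, k) = f - \<bar>d\<bar>\<close> for \<open>\<bar>d\<bar> \<le> f\<close>: each \<open>\<eta>(q,j)\<close> is the summit of a mountain of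
  height and half-width \<open>f\<close>. Distinct mountains do not overlap, and their widths add up to the sum of
  \<open>2 \<phi>(q) \<lfloor>k / q\<rfloor>\<close> over \<open>q \<le> k\<close>, which is the period \<open>k\<^sup>2 + k\<close>. So they cover all residues and
  there is no other peak.
\<close>

section \<open>Residues in a window of integers\<close>

lemma mod_eq_imp_eq_in_window:
  fixes x y a p :: int
  assumes "x mod p = y mod p" "a \<le> x" "x < a + p" "a \<le> y" "y < a + p"
  shows "x = y"
proof -
  have "p dvd x - y" using assms(1) by (simp add: mod_eq_dvd_iff)
  thus ?thesis using assms dvd_imp_le_int[of "x - y" p] by linarith
qed

lemma int_shift_induct [consumes 2, case_names base step]:
  fixes p :: int
  assumes "a \<le> b" and "p > 0"
    and "\<And>b. a \<le> b \<Longrightarrow> b < a + p \<Longrightarrow> P b"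
    and "\<And>b. a + p \<le> b \<Longrightarrow> P (b - p) \<Longrightarrow> P b"
  shows "P b"
  using assms(1)
proof (induction "nat (b - a)" arbitrary: b rule: less_induct)
  case less
  show ?case
  proof (cases "b < a + p")
    case True thus ?thesis using less assms(3) by auto
  next
    case False thus ?thesis using less(1)[of "b - p"] assms(2,4) by auto
  qed
qed

lemma sum_periodic:
  fixes p :: int
  assumes "p > 0"
  shows "(\<Sum>l\<in>{a<..a + p}. f (l mod p)) = (\<Sum>l\<in>{0..<p}. f l)"
proof (rule sum.reindex_bij_betw)
  have "inj_on (\<lambda>l. l mod p) {a<..a + p}"
    by (rule inj_onI) (auto dest: mod_eq_imp_eq_in_window[of _ p _ "a + 1"])
  moreover have "(\<lambda>l. l mod p) ` {a<..a + p} \<subseteq> {0..<p}"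
    using assms by auto
  ultimately show "bij_betw (\<lambda>l. l mod p) {a<..a + p} {0..<p}"
    by (intro bij_betw_imageI card_subset_eq) (auto simp: card_image)
qed

section \<open>Matrix kernels with a dual family\<close>

lemma (in kernel) scalar_prod_lincomb:
  assumes "B \<subseteq> mat_kernel A" and "p \<in> carrier_vec nc"
  shows "p \<bullet> lincomb a B = (\<Sum>v\<in>B. a v * (p \<bullet> v))"
proof -
  have dim_kernel: "dim_vec v = nc" if "v \<in> mat_kernel A" for v
    using mat_kernel_carrier[OF A] that by auto
  have "p \<bullet> lincomb a B = (\<Sum>i<nc. \<Sum>v\<in>B. a v * (p $ i * v $ i))"
    unfolding scalar_prod_def using assms(1) dim_kernel[OF Ker.lincomb_closed[OF assms(1)]]
    by (simp add: lincomb_index sum_distrib_left mult.left_commute atLeast0LessThan)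
  also have "\<dots> = (\<Sum>v\<in>B. \<Sum>i<nc. a v * (p $ i * v $ i))"
    by (rule sum.swap)
  also have "\<dots> = (\<Sum>v\<in>B. a v * (p \<bullet> v))"
    unfolding scalar_prod_def using assms(1) dim_kernel
    by (intro sum.cong) (auto simp: sum_distrib_left atLeast0LessThan)
  finally show ?thesis .
qed

locale kernel_dual_family = kernel +
  fixes I :: "'i set" and b p :: "'i \<Rightarrow> 'a vec"
  assumes finite: "finite I"
    and family_in_kernel: "i \<in> I \<Longrightarrow> b i \<in> mat_kernel A"
    and functional_carrier: "i \<in> I \<Longrightarrow> p i \<in> carrier_vec nc"
    and dual: "i \<in> I \<Longrightarrow> i' \<in> I \<Longrightarrow> p i \<bullet> b i' = (if i = i' then 1 else 0)"
    and separating: "x \<in> mat_kernel A \<Longrightarrow> (\<And>i. i \<in> I \<Longrightarrow> p i \<bullet> x = 0) \<Longrightarrow> x = 0\<^sub>v nc"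
begin

lemma family_subset: "b ` I \<subseteq> mat_kernel A"
  using family_in_kernel by auto

lemma inj_on_family: "inj_on b I"
proof (rule inj_onI)
  fix i i' assume "i \<in> I" "i' \<in> I" "b i = b i'"
  with dual[of i i] dual[of i i'] show "i = i'" by (auto split: if_splits)
qed

lemma coordinate_lincomb:
  assumes "i \<in> I"
  shows "p i \<bullet> lincomb a (b ` I) = a (b i)"
proof -
  have "p i \<bullet> lincomb a (b ` I) = (\<Sum>i'\<in>I. a (b i') * (p i \<bullet> b i'))"
    using scalar_prod_lincomb[OF family_subset functional_carrier[OF assms]]
    by (simp add: sum.reindex[OF inj_on_family])
  also have "\<dots> = (\<Sum>i'\<in>I. if i = i' then a (b i') else 0)"
    using assms dual by (intro sum.cong) auto
  finally show ?thesis using assms finite by simp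
qed

lemma in_span_family:
  assumes x_in_kernel: "x \<in> mat_kernel A"
  shows "x \<in> span (b ` I)"
proof -
  define y where "y = lincomb (\<lambda>v. p (the_inv_into I b v) \<bullet> x) (b ` I)"
  have y_in_kernel: "y \<in> mat_kernel A"
    unfolding y_def using Ker.lincomb_closed[OF family_subset] by auto
  note carrier = mat_kernelD(1)[OF A x_in_kernel] mat_kernelD(1)[OF A y_in_kernel]
  have "x - y = 0\<^sub>v nc"
  proof (rule separating)
    show "x - y \<in> mat_kernel A"
      using mat_kernelD[OF A x_in_kernel] mat_kernelD[OF A y_in_kernel] A
      by (intro mat_kernelI[OF A]) (auto simp: mult_minus_distrib_mat_vec)
    fix i assume i_in_I: "i \<in> I"
    have "p i \<bullet> y = p i \<bullet> x"
      unfolding y_def coordinate_lincomb[OF i_in_I]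
      by (simp add: the_inv_into_f_f[OF inj_on_family i_in_I])
    thus "p i \<bullet> (x - y) = 0"
      using scalar_prod_minus_distrib[OF functional_carrier[OF i_in_I] carrier] by simp
  qed
  have "x = y"
  proof (rule eq_vecI)
    fix l assume "l < dim_vec y"
    thus "x $ l = y $ l" using arg_cong[OF \<open>x - y = 0\<^sub>v nc\<close>, of "\<lambda>v. v $ l"] carrier by auto
  qed (use carrier in auto)
  thus ?thesis
    unfolding y_def Ker.span_def using finite by auto
qed

lemma basis_family: "basis (b ` I)"
  unfolding Ker.basis_def
proof (intro conjI)
  show "span (b ` I) = mat_kernel A"
    using Ker.span_is_subset2[OF family_subset] in_span_family by auto
  have "a v = 0" if "lincomb a (b ` I) = 0\<^sub>v nc" and "v \<in> b ` I" for a v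
    using that coordinate_lincomb[of _ a] functional_carrier by auto
  thus "\<not> lin_dep (b ` I)"
    using finite by (intro Ker.finite_lin_indpt2[OF _ family_subset]) (auto simp: class_field_def)
qed (rule family_subset)

theorem kernel_dim_eq_card: "kernel_dim A = card I"
  using Ker.dim_basis[OF _ basis_family] finite A by (simp add: card_image[OF inj_on_family])

end

section \<open>Components\<close>

abbreviation connected_in :: "('a \<times> 'a) set \<Rightarrow> 'a \<Rightarrow> 'a \<Rightarrow> bool" where
  "connected_in E \<equiv> equivclp (\<lambda>x y. (x, y) \<in> E)"

definition component :: "('a \<times> 'a) set \<Rightarrow> 'a \<Rightarrow> 'a set" where
  "component E x = {y. connected_in E x y}"

definition components :: "'a set \<Rightarrow> ('a \<times> 'a) set \<Rightarrow> 'a set set" where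
  "components V E = component E ` V"

lemma component_eq_iff: "component E x = component E y \<longleftrightarrow> connected_in E x y"
  unfolding component_def by (auto intro: equivclp_sym equivclp_trans)

lemma component_eq_if_edge: "(x, y) \<in> E \<Longrightarrow> component E x = component E y"
  unfolding component_eq_iff by auto

lemma constant_on_connected:
  assumes "connected_in E x y" and "\<And>x y. (x, y) \<in> E \<Longrightarrow> h x = h y"
  shows "h x = h y"
  using assms(1) by (induction rule: equivclp_induct) (auto dest: assms(2))

lemma card_components_eq:
  assumes const_on_edges: "\<And>x y. (x, y) \<in> E \<Longrightarrow> h x = h y"
    and representative: "\<And>x. x \<in> V \<Longrightarrow> connected_in E x (g (h x))"
  shows "card (components V E) = card (h ` V)"
proof -
  have "component E x = component E (g (h x))" if "x \<in> V" for x
    unfolding component_eq_iff using representative[OF that] .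
  hence "components V E = (\<lambda>c. component E (g c)) ` h ` V"
    unfolding components_def image_image by (rule image_cong[OF refl])
  moreover have "inj_on (\<lambda>c. component E (g c)) (h ` V)"
  proof (rule inj_onI, elim imageE)
    fix c d x y
    assume same_component: "component E (g c) = component E (g d)"
      and c_eq: "c = h x" "x \<in> V" and d_eq: "d = h y" "y \<in> V"
    have "connected_in E x y"
      using representative[OF c_eq(2)] representative[OF d_eq(2)] same_component
      unfolding c_eq d_eq component_eq_iff[symmetric] by simp
    thus "c = d" using constant_on_connected[of E x y h] const_on_edges c_eq(1) d_eq(1) by simp
  qed
  ultimately show ?thesis by (simp add: card_image)
qed

lemma connected_in_map_prod:
  assumes "connected_in E x y"
  shows "connected_in (map_prod \<sigma> \<sigma> ` E) (\<sigma> x) (\<sigma> y)"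
  using assms
proof (induction rule: equivclp_induct)
  case (step y z)
  hence "connected_in (map_prod \<sigma> \<sigma> ` E) (\<sigma> y) (\<sigma> z)" by force
  with step.IH show ?case by (rule equivclp_trans)
qed simp

lemma card_components_isomorphic:
  assumes inverse: "\<And>x. x \<in> V \<Longrightarrow> \<tau> (\<sigma> x) = x"
    and \<sigma>: "map_prod \<sigma> \<sigma> ` E = E'" and \<tau>: "map_prod \<tau> \<tau> ` E' = E"
  shows "card (components (\<sigma> ` V) E') = card (components V E)"
proof -
  define g where "g C = \<tau> (SOME y. component E' y = C)" for C
  have "card (components V E) = card ((\<lambda>x. component E' (\<sigma> x)) ` V)"
  proof (rule card_components_eq[where g = g])
    fix x y assume "(x, y) \<in> E"
    thus "component E' (\<sigma> x) = component E' (\<sigma> y)"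
      unfolding \<sigma>[symmetric] by (intro component_eq_if_edge) force
  next
    fix x assume x_in_V: "x \<in> V"
    define y where "y = (SOME y. component E' y = component E' (\<sigma> x))"
    have "component E' y = component E' (\<sigma> x)" unfolding y_def by (rule someI) (rule refl)
    hence "connected_in E' (\<sigma> x) y" by (simp flip: component_eq_iff)
    from connected_in_map_prod[OF this, of \<tau>] show "connected_in E x (g (component E' (\<sigma> x)))"
      unfolding \<tau> inverse[OF x_in_V] g_def y_def .
  qed
  thus ?thesis unfolding components_def by (simp add: image_image)
qed

section \<open>The graphs \<open>G(n,k)\<close>\<close>

definition edge :: "int \<Rightarrow> int \<Rightarrow> int \<times> int" where
  "edge k e = (e mod (k + 1), (e + 1) mod k)"

lemma G_edges_eq_image_edge: "G_edges n k = edge k ` {n - 1..<n - 1 + k}"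
proof -
  have "G_edges n k = (\<lambda>i. edge k (i + (n - 2))) ` {1..k}"
    unfolding G_edges_def edge_def by (auto simp: algebra_simps)
  also have "\<dots> = edge k ` ((\<lambda>i. i + (n - 2)) ` {1..k})" by (simp only: image_image)
  also have "(\<lambda>i. i + (n - 2)) ` {1..k} = {n - 1..<n - 1 + k}"
    by (auto simp: image_iff intro: bexI[of _ "_ - (n - 2)"])
  finally show ?thesis .
qed

lemma G_edges_functional:
  assumes "(x, y) \<in> G_edges n k" "(x, y') \<in> G_edges n k"
  shows "y = y'"
proof -
  obtain e e' where edges: "e \<in> {n - 1..<n - 1 + k}" "e' \<in> {n - 1..<n - 1 + k}"
    "(x, y) = edge k e" "(x, y') = edge k e'"
    using assms unfolding G_edges_eq_image_edge by blast
  hence "e = e'"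
    using mod_eq_imp_eq_in_window[of e "k + 1" e' "n - 1"] by (auto simp: edge_def)
  thus ?thesis using edges by (simp add: edge_def)
qed

lemma G_edges_periodic: "G_edges (n + (k\<^sup>2 + k) * z) k = G_edges n k"
proof -
  have "edge k (e + (k\<^sup>2 + k) * z) = edge k e" for e
  proof -
    have "e + (k\<^sup>2 + k) * z = e + (k + 1) * (k * z)"
      "e + (k\<^sup>2 + k) * z + 1 = e + 1 + k * ((k + 1) * z)"
      by (simp_all add: power2_eq_square algebra_simps)
    thus ?thesis unfolding edge_def by (metis mod_mult_self2)
  qed
  hence "edge k ` {n - 1..<n - 1 + k} = edge k ` (\<lambda>e. e + (k\<^sup>2 + k) * z) ` {n - 1..<n - 1 + k}"
    by (simp add: image_image del: image_add_atLeastLessThan')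
  thus ?thesis unfolding G_edges_eq_image_edge by (simp add: algebra_simps)
qed

text \<open>Replacing \<open>n\<close> by \<open>n + d\<close> keeps the targets of all edges and moves \<open>d\<close> sources down by one.\<close>
lemma G_edges_shift:
  assumes "0 \<le> d" "d \<le> k"
  shows "G_edges (n + d) k = edge k ` {n - 1 + d..<n - 1 + k} \<union>
    (\<lambda>e. ((e - 1) mod (k + 1), (e + 1) mod k)) ` {n - 1..<n - 1 + d}"
proof -
  have "edge k (e + k) = ((e - 1) mod (k + 1), (e + 1) mod k)" for e
    using mod_add_self2[of "e - 1" "k + 1"] mod_add_self2[of "e + 1" k]
    unfolding edge_def by (simp add: algebra_simps)
  hence "edge k ` {n - 1 + k..<n - 1 + d + k} =
      (\<lambda>e. ((e - 1) mod (k + 1), (e + 1) mod k)) ` {n - 1..<n - 1 + d}"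
    unfolding image_add_atLeastLessThan'[symmetric] image_image by simp
  moreover have "{n + d - 1..<n + d - 1 + k} = {n - 1 + d..<n - 1 + k} \<union> {n - 1 + k..<n - 1 + d + k}"
    using assms by auto
  ultimately show ?thesis unfolding G_edges_eq_image_edge by (simp add: image_Un)
qed

text \<open>Exchanges \<open>x\<close> and \<open>k - 1 - x\<close> for \<open>x < k\<close>, and fixes \<open>k\<close>.\<close>
definition reflection :: "int \<Rightarrow> int \<Rightarrow> int" where
  "reflection k x = (- 2 - x) mod (k + 1)"

lemma reflection_involution: "x \<in> G_verts k \<Longrightarrow> reflection k (reflection k x) = x"
  unfolding reflection_def G_verts_def by (simp add: mod_diff_right_eq)

lemma G_edges_reflection:
  assumes k_pos: "k \<ge> 1"
  shows "map_prod (reflection k) (reflection k) ` G_edges n k = G_edges (- 2 * k - n) k"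
proof -
  have "map_prod (reflection k) (reflection k) (edge k e) = edge k (- k - 3 - e)" for e
  proof -
    have "reflection k (e mod (k + 1)) = (- k - 3 - e + (k + 1)) mod (k + 1)"
      unfolding reflection_def mod_diff_right_eq
      by (rule arg_cong[where f = "\<lambda>x. x mod (k + 1)"]) simp
    moreover have "reflection k ((e + 1) mod k) = (- k - 3 - e + 1) mod k"
    proof -
      define y where "y = (e + 1) mod k"
      have y_range: "0 \<le> y" "y < k" unfolding y_def using k_pos by auto
      have "reflection k y = (k - 1 - y + - 1 * (k + 1)) mod (k + 1)"
        unfolding reflection_def by simp
      also have "\<dots> = (k - 1 - y) mod (k + 1)" by (rule mod_mult_self1)
      also have "\<dots> = (k - 1 - y) mod k" using y_range by simp
      also have "\<dots> = (k - 1 - (e + 1)) mod k" unfolding y_def by (simp add: mod_diff_right_eq)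
      also have "\<dots> = (- k - 3 - e + 1 + 2 * k) mod k" by (simp add: algebra_simps)
      finally show ?thesis unfolding y_def mod_mult_self1 .
    qed
    ultimately show ?thesis unfolding edge_def mod_add_self2 by simp
  qed
  hence "map_prod (reflection k) (reflection k) ` G_edges n k =
      edge k ` (\<lambda>e. - k - 3 - e) ` {n - 1..<n - 1 + k}"
    unfolding G_edges_eq_image_edge image_image by simp
  also have "(\<lambda>e. - k - 3 - e) ` {n - 1..<n - 1 + k} = {- 2 * k - n - 1..<- 2 * k - n - 1 + k}"
    by (auto simp: image_iff intro: bexI[of _ "- k - 3 - _"])
  finally show ?thesis unfolding G_edges_eq_image_edge .
qed

lemma reflection_image_G_verts:
  assumes "k \<ge> 1"
  shows "reflection k ` G_verts k = G_verts k"
proof -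
  have "reflection k x \<in> G_verts k" for x
    using assms pos_mod_bound[of "k + 1" "- 2 - x"] unfolding reflection_def G_verts_def by auto
  thus ?thesis
    using reflection_involution by (metis image_eqI image_subsetI subsetI subset_antisym)
qed

lemma card_components_reflection:
  assumes k_pos: "k \<ge> 1"
  shows "card (components (G_verts k) (G_edges (- 2 * k - n) k)) =
    card (components (G_verts k) (G_edges n k))"
  using card_components_isomorphic[where V = "G_verts k",
      OF reflection_involution G_edges_reflection[OF k_pos]]
    G_edges_reflection[OF k_pos, of "- 2 * k - n"] reflection_image_G_verts[OF k_pos] by simp

section \<open>The kernel of the Toeplitz matrix\<close>

definition partial_sum :: "'a :: comm_ring_1 vec \<Rightarrow> int \<Rightarrow> 'a" where
  "partial_sum x c = vec (dim_vec x) (\<lambda>l. of_bool (int l \<le> c)) \<bullet> x"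

lemma partial_sum_eq_sum: "partial_sum x c = (\<Sum>l<dim_vec x. of_bool (int l \<le> c) * x $ l)"
  unfolding partial_sum_def scalar_prod_def by (simp add: atLeast0LessThan)

lemma partial_sum_neg: "c < 0 \<Longrightarrow> partial_sum x c = 0"
  unfolding partial_sum_eq_sum by (intro sum.neutral) auto

lemma partial_sum_ge_dim:
  "int (dim_vec x) - 1 \<le> c \<Longrightarrow> partial_sum x c = partial_sum x (int (dim_vec x) - 1)"
  unfolding partial_sum_eq_sum by (intro sum.cong) auto

lemma partial_sum_step:
  "partial_sum x c - partial_sum x (c - 1) = (if 0 \<le> c \<and> c < int (dim_vec x) then x $ nat c else 0)"
proof -
  have "partial_sum x c - partial_sum x (c - 1) = (\<Sum>l<dim_vec x. if int l = c then x $ l else 0)"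
    unfolding partial_sum_eq_sum sum_subtractf[symmetric] by (intro sum.cong) auto
  also have "\<dots> = (\<Sum>l<dim_vec x. if l = nat c \<and> 0 \<le> c then x $ l else 0)"
    by (intro sum.cong) auto
  also have "\<dots> = (if 0 \<le> c \<and> c < int (dim_vec x) then x $ nat c else 0)"
    by (auto simp: nat_less_iff)
  finally show ?thesis .
qed

lemma A_mat_carrier: "A_mat n k \<in> carrier_mat n n"
  unfolding A_mat_def by simp

lemma A_mat_mult_vec_index:
  assumes x_carrier: "x \<in> carrier_vec n" and a_less: "a < n"
  shows "(A_mat n k *\<^sub>v x) $ a = partial_sum x (int a + int k) + partial_sum x (int a - int k - 1)
    - partial_sum x (int a) - partial_sum x (int a - 1)"
proof -
  have "(A_mat n k *\<^sub>v x) $ a = (\<Sum>l<n. A_mat n k $$ (a, l) * x $ l)"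
    using a_less x_carrier A_mat_carrier[of n k] by (simp add: scalar_prod_def atLeast0LessThan)
  also have "\<dots> = (\<Sum>l<n. of_bool (int l \<le> int a + int k) * x $ l
      + of_bool (int l \<le> int a - int k - 1) * x $ l
      - of_bool (int l \<le> int a) * x $ l - of_bool (int l \<le> int a - 1) * x $ l)"
    using a_less by (intro sum.cong) (auto simp: A_mat_def)
  finally show ?thesis
    using x_carrier unfolding partial_sum_eq_sum by (simp add: sum.distrib sum_subtractf)
qed

lemma mat_kernel_A_mat_iff:
  assumes k_nonneg: "k \<ge> 0" and x_carrier: "x \<in> carrier_vec n"
  shows "x \<in> mat_kernel (A_mat n (nat k)) \<longleftrightarrow> (\<forall>a. 0 \<le> a \<and> a < int n \<longrightarrow>
    partial_sum x (a + k) - partial_sum x a = partial_sum x (a - 1) - partial_sum x (a - 1 - k))"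
proof -
  have "x \<in> mat_kernel (A_mat n (nat k)) \<longleftrightarrow> (\<forall>a<n. (A_mat n (nat k) *\<^sub>v x) $ a = 0)"
    using x_carrier A_mat_carrier[of n "nat k"] unfolding mat_kernel_def
    by (auto simp del: index_mult_mat_vec intro!: eq_vecI)
  also have "\<dots> \<longleftrightarrow> (\<forall>a<n. partial_sum x (int a + k) - partial_sum x (int a) =
      partial_sum x (int a - 1) - partial_sum x (int a - 1 - k))"
    using k_nonneg A_mat_mult_vec_index[OF x_carrier, of _ "nat k"] by (auto simp: algebra_simps)
  also have "\<dots> \<longleftrightarrow> (\<forall>a. 0 \<le> a \<and> a < int n \<longrightarrow>
      partial_sum x (a + k) - partial_sum x a = partial_sum x (a - 1) - partial_sum x (a - 1 - k))"
    by (metis nonneg_int_cases of_nat_0_le_iff of_nat_less_iff)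
  finally show ?thesis .
qed

locale toeplitz_kernel =
  fixes k :: int and n :: nat and x :: "real vec"
  assumes k_pos: "k \<ge> 1" and x_in_kernel: "x \<in> mat_kernel (A_mat n (nat k))"
begin

definition vertex_weight :: "int \<Rightarrow> real" where
  "vertex_weight c = (if c = k then 0 else partial_sum x c)"

lemma partial_sum_recurrence:
  "0 \<le> a \<Longrightarrow> a < int n \<Longrightarrow>
    partial_sum x (a + k) - partial_sum x a = partial_sum x (a - 1) - partial_sum x (a - 1 - k)"
  using x_in_kernel k_pos mat_kernelD(1)[OF A_mat_carrier x_in_kernel] mat_kernel_A_mat_iff[of k x n]
  by simp

lemma partial_sum_diff_k:
  assumes "- k - 1 \<le> b" "b < int n"
  shows "partial_sum x (b + k) - partial_sum x b = vertex_weight ((b + k) mod (k + 1))"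
proof -
  have "k + 1 > 0" using k_pos by simp
  from assms(1) this show ?thesis using assms(2)
  proof (induction b rule: int_shift_induct)
    case (base b)
    have "(b + k) mod (k + 1) = (if b = - k - 1 then k else b + k)"
      using base k_pos by (auto simp: zmod_minus1)
    thus ?case using base k_pos unfolding vertex_weight_def by (auto simp: partial_sum_neg)
  next
    case (step b)
    have "partial_sum x (b + k) - partial_sum x b = vertex_weight ((b - (k + 1) + k) mod (k + 1))"
      using partial_sum_recurrence[of b] step k_pos by (simp add: algebra_simps)
    also have "(b - (k + 1) + k) mod (k + 1) = (b + k) mod (k + 1)"
      using minus_mod_self2[of "b + k" "k + 1"] by (simp add: algebra_simps)
    finally show ?case .
  qed
qed

lemma partial_sum_diff_Suc_k:
  assumes "- k - 1 \<le> b" "b < int n - 1"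
  shows "partial_sum x (b + k + 1) - partial_sum x b = vertex_weight ((b + k + 1) mod k)"
proof -
  have "k > 0" using k_pos by simp
  from assms(1) this show ?thesis using assms(2)
  proof (induction b rule: int_shift_induct)
    case (base b)
    thus ?case using k_pos unfolding vertex_weight_def by (auto simp: partial_sum_neg)
  next
    case (step b)
    have "partial_sum x (b + k + 1) - partial_sum x b = vertex_weight ((b - k + k + 1) mod k)"
      using partial_sum_recurrence[of "b + 1"] step k_pos by (simp add: algebra_simps)
    also have "(b - k + k + 1) mod k = (b + k + 1) mod k"
      using mod_add_self2[of "b + 1" k] by (simp add: algebra_simps)
    finally show ?case .
  qed
qed

lemma partial_sum_step_eq_vertex_weight_diff:
  assumes "- 1 \<le> e" "e < int n - 1 + k"
  shows "partial_sum x (e + 1) - partial_sum x e =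
    vertex_weight ((e + 1) mod k) - vertex_weight (e mod (k + 1))"
  using partial_sum_diff_k[of "e - k"] partial_sum_diff_Suc_k[of "e - k"] assms by simp

lemma vertex_weight_const_on_edges:
  assumes "(y, z) \<in> G_edges (int n) k"
  shows "vertex_weight y = vertex_weight z"
proof -
  obtain e where window: "int n - 1 \<le> e" "e < int n - 1 + k" "(y, z) = edge k e"
    using assms unfolding G_edges_eq_image_edge by auto
  moreover have "dim_vec x = n"
    using mat_kernelD(1)[OF A_mat_carrier x_in_kernel] by simp
  ultimately have "partial_sum x (e + 1) = partial_sum x e"
    using partial_sum_ge_dim[of x "e + 1"] partial_sum_ge_dim[of x e] by simp
  thus ?thesis
    using partial_sum_step_eq_vertex_weight_diff[of e] window by (simp add: edge_def)
qed

lemma zero_if_vertex_weight_zero: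
  assumes zero: "\<And>c. 0 \<le> c \<Longrightarrow> c < k \<Longrightarrow> vertex_weight c = 0"
  shows "x = 0\<^sub>v n"
proof (rule eq_vecI)
  have dim_x: "dim_vec x = n" using mat_kernelD(1)[OF A_mat_carrier x_in_kernel] by simp
  have "vertex_weight c = 0" if "0 \<le> c" "c \<le> k" for c
    using zero[of c] that unfolding vertex_weight_def by auto
  hence "vertex_weight (e mod k) = 0" "vertex_weight (e mod (k + 1)) = 0" for e
    using k_pos less_imp_le[OF pos_mod_bound[of k e]] pos_mod_bound[of "k + 1" e] by simp_all
  hence step: "partial_sum x e = partial_sum x (e - 1)" if "0 \<le> e" "e < int n" for e
    using partial_sum_step_eq_vertex_weight_diff[of "e - 1"] that k_pos by simp
  show "x $ l = 0\<^sub>v n $ l" if "l < dim_vec (0\<^sub>v n)" for l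
    using partial_sum_step[of x "int l"] step[of "int l"] that dim_x by simp
  show "dim_vec x = dim_vec (0\<^sub>v n)" using dim_x by simp
qed

lemma zero_if_zero_on_transversal:
  assumes T_subset: "T \<subseteq> {0..<k}" and zero: "\<And>d. d \<in> T \<Longrightarrow> partial_sum x d = 0"
    and cover: "\<And>c. c \<in> {0..<k} \<Longrightarrow> \<not> connected_in (G_edges (int n) k) c k \<Longrightarrow>
      \<exists>d\<in>T. connected_in (G_edges (int n) k) c d"
  shows "x = 0\<^sub>v n"
proof (rule zero_if_vertex_weight_zero)
  fix c assume c_range: "0 \<le> c" "c < k"
  have const: "vertex_weight c = vertex_weight d" if "connected_in (G_edges (int n) k) c d" for d
    using that vertex_weight_const_on_edges by (rule constant_on_connected)
  show "vertex_weight c = 0"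
  proof (cases "connected_in (G_edges (int n) k) c k")
    case True
    thus ?thesis using const[of k] by (simp add: vertex_weight_def)
  next
    case False
    then obtain d where "d \<in> T" "connected_in (G_edges (int n) k) c d"
      using cover[of c] c_range by auto
    thus ?thesis using const[of d] zero[of d] T_subset by (auto simp: vertex_weight_def)
  qed
qed

end

definition kernel_entry :: "int \<Rightarrow> (int \<Rightarrow> real) \<Rightarrow> int \<Rightarrow> real" where
  "kernel_entry k u l = u (l mod k) - u ((l - 1) mod (k + 1))"

definition kernel_vec :: "int \<Rightarrow> nat \<Rightarrow> (int \<Rightarrow> real) \<Rightarrow> real vec" where
  "kernel_vec k n u = vec n (\<lambda>l. kernel_entry k u (int l))"

lemma kernel_vec_carrier: "kernel_vec k n u \<in> carrier_vec n"
  unfolding kernel_vec_def by simp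

lemma sum_kernel_entry_recurrence:
  assumes "k \<ge> 1"
  shows "(\<Sum>l\<in>{a<..a + k}. kernel_entry k u l) = (\<Sum>l\<in>{a - 1 - k<..a - 1}. kernel_entry k u l)"
proof -
  define total where "total = (\<Sum>l\<in>{0..<k}. u l) - (\<Sum>l\<in>{0..<k + 1}. u ((l - 1) mod (k + 1)))"
  have "(\<Sum>l\<in>{b<..b + k}. kernel_entry k u l) = total + u ((b + k) mod (k + 1))" for b
  proof -
    have "(\<Sum>l\<in>{b<..b + (k + 1)}. u ((l - 1) mod (k + 1)))
        = (\<Sum>l\<in>{b<..b + (k + 1)}. u ((l mod (k + 1) - 1) mod (k + 1)))"
      by (simp add: mod_diff_left_eq)
    also have "\<dots> = (\<Sum>l\<in>{0..<k + 1}. u ((l - 1) mod (k + 1)))"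
      using assms by (intro sum_periodic) simp
    also have "{b<..b + (k + 1)} = insert (b + k + 1) {b<..b + k}" using assms by auto
    finally show ?thesis
      using sum_periodic[where p = k and a = b and f = u] assms
      unfolding kernel_entry_def total_def
      by (simp add: sum_subtractf)
  qed
  from this[of a] this[of "a - 1 - k"] show ?thesis
    using mod_add_self2[of "a - 1" "k + 1"] by (simp add: algebra_simps)
qed

locale edge_constant_weight =
  fixes k :: int and n :: nat and u :: "int \<Rightarrow> real"
  assumes k_pos: "k \<ge> 1" and weight_k: "u k = 0"
    and weight_edge: "\<And>x y. (x, y) \<in> G_edges (int n) k \<Longrightarrow> u x = u y"
begin

lemma partial_sum_kernel_vec_step:
  assumes "- k \<le> c" "c < int n + k"
  shows "partial_sum (kernel_vec k n u) c - partial_sum (kernel_vec k n u) (c - 1) =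
    kernel_entry k u c"
proof -
  consider (negative) "c < 0" | (inside) "0 \<le> c" "c < int n" | (beyond) "int n \<le> c" by linarith
  thus ?thesis
  proof cases
    case negative
    have "c mod k = (c + k) mod k" "(c - 1) mod (k + 1) = (c + k) mod (k + 1)"
      using mod_add_self2[of "c - 1" "k + 1"] by (simp_all add: algebra_simps)
    hence "c mod k = c + k" "(c - 1) mod (k + 1) = c + k"
      using negative assms by (simp_all only: mod_pos_pos_trivial)
    thus ?thesis using negative unfolding partial_sum_step kernel_entry_def kernel_vec_def by simp
  next
    case beyond
    have "edge k (c - 1) \<in> G_edges (int n) k"
      using beyond assms unfolding G_edges_eq_image_edge by auto
    hence "u ((c - 1) mod (k + 1)) = u (c mod k)" using weight_edge unfolding edge_def by simp
    thus ?thesis using beyond unfolding partial_sum_step kernel_entry_def kernel_vec_def by simp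
  next
    case inside
    hence "int (nat c) = c" by simp
    thus ?thesis using inside unfolding partial_sum_step kernel_vec_def by (simp del: int_nat_eq)
  qed
qed

lemma partial_sum_kernel_vec_window:
  assumes "a \<le> b" "- k - 1 \<le> a" "b < int n + k"
  shows "partial_sum (kernel_vec k n u) b - partial_sum (kernel_vec k n u) a =
    (\<Sum>l\<in>{a<..b}. kernel_entry k u l)"
  using assms
proof (induction b rule: int_ge_induct)
  case (step b)
  have "{a<..b + 1} = insert (b + 1) {a<..b}" using step.hyps by auto
  thus ?case using step partial_sum_kernel_vec_step[of "b + 1"] by simp
qed simp

lemma kernel_vec_in_kernel: "kernel_vec k n u \<in> mat_kernel (A_mat n (nat k))"
  using k_pos sum_kernel_entry_recurrence[where u = u] partial_sum_kernel_vec_window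
  by (subst mat_kernel_A_mat_iff[OF _ kernel_vec_carrier]) auto

lemma partial_sum_kernel_vec:
  assumes "0 \<le> c" "c < k"
  shows "partial_sum (kernel_vec k n u) c = u c"
  using assms
proof (induction c rule: int_ge_induct)
  case base
  thus ?case using partial_sum_kernel_vec_step[of 0] k_pos weight_k
    by (simp add: partial_sum_neg kernel_entry_def zmod_minus1)
next
  case (step c)
  thus ?case using partial_sum_kernel_vec_step[of "c + 1"] k_pos by (simp add: kernel_entry_def)
qed

end

lemma edge_constant_weight_of_bool_connected:
  fixes n :: nat and k :: int
  defines "conn \<equiv> connected_in (G_edges (int n) k)"
  assumes "k \<ge> 1" and "\<not> conn d k"
  shows "edge_constant_weight k n (\<lambda>y. of_bool (conn d y))"
proof
  show "of_bool (conn d y) = (of_bool (conn d z) :: real)" if "(y, z) \<in> G_edges (int n) k" for y z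
    unfolding conn_def component_eq_iff[symmetric] component_eq_if_edge[OF that] ..
qed (use assms in auto)

text \<open>The weights vanishing at \<open>k\<close> and constant along edges have one coordinate for each component
  other than that of \<open>k\<close>.\<close>
lemma nullity_eq_card_transversal:
  fixes n :: nat and k :: int
  defines "conn \<equiv> connected_in (G_edges (int n) k)"
  assumes k_pos: "k \<ge> 1" and T_subset: "T \<subseteq> {0..<k}"
    and avoids_k: "\<And>d. d \<in> T \<Longrightarrow> \<not> conn d k"
    and distinct: "\<And>d d'. d \<in> T \<Longrightarrow> d' \<in> T \<Longrightarrow> conn d d' \<Longrightarrow> d = d'"
    and cover: "\<And>c. c \<in> {0..<k} \<Longrightarrow> \<not> conn c k \<Longrightarrow> \<exists>d\<in>T. conn c d"
  shows "nullity n (nat k) = card T"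
proof -
  define b where "b d = kernel_vec k n (\<lambda>y. of_bool (conn d y))" for d
  define p :: "int \<Rightarrow> real vec" where "p d = vec n (\<lambda>l. of_bool (int l \<le> d))" for d
  have weight: "edge_constant_weight k n (\<lambda>y. of_bool (conn d y))" if "d \<in> T" for d
    using avoids_k[OF that] edge_constant_weight_of_bool_connected[OF k_pos]
    unfolding conn_def by simp
  have p_eq_psum: "p d \<bullet> x = partial_sum x d" if "x \<in> carrier_vec n" for x d
    using that unfolding partial_sum_def p_def by simp
  interpret kernel_dual_family n n "A_mat n (nat k)" T b p
  proof
    show "A_mat n (nat k) \<in> carrier_mat n n" by (rule A_mat_carrier)
    show "finite T" using T_subset by (rule finite_subset) simp
    show "b d \<in> mat_kernel (A_mat n (nat k))" if "d \<in> T" for d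
      unfolding b_def by (rule edge_constant_weight.kernel_vec_in_kernel[OF weight[OF that]])
    show "p d \<bullet> b d' = (if d = d' then 1 else 0)" if "d \<in> T" "d' \<in> T" for d d'
    proof -
      have "p d \<bullet> b d' = of_bool (conn d' d)"
        using edge_constant_weight.partial_sum_kernel_vec[OF weight[OF that(2)], of d] that(1) T_subset
          p_eq_psum[OF kernel_vec_carrier] unfolding b_def by auto
      also have "conn d' d \<longleftrightarrow> d = d'"
        using distinct[OF that(2,1)] unfolding conn_def by auto
      finally show ?thesis by simp
    qed
    fix x assume x_in_kernel: "x \<in> mat_kernel (A_mat n (nat k))"
      and zero: "\<And>d. d \<in> T \<Longrightarrow> p d \<bullet> x = 0"
    interpret toeplitz_kernel k n x using k_pos x_in_kernel by unfold_locales
    show "x = 0\<^sub>v n"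
      using zero_if_zero_on_transversal[OF T_subset _ cover[unfolded conn_def]] zero
        p_eq_psum[OF mat_kernelD(1)[OF A_mat_carrier x_in_kernel]] by simp
  qed (simp add: p_def)
  show ?thesis unfolding nullity_def by (rule kernel_dim_eq_card)
qed

theorem nullity_eq_card_components:
  assumes k_pos: "k \<ge> 1"
  shows "nullity n (nat k) + 1 = card (components (G_verts k) (G_edges (int n) k))"
proof -
  define E where "E = G_edges (int n) k"
  define I where "I = components (G_verts k) E - {component E k}"
  define rep where "rep = inv_into (G_verts k) (component E)"
  have rep_in_component: "rep C \<in> G_verts k" "component E (rep C) = C" if "C \<in> I" for C
    using that
    unfolding rep_def I_def components_def by (simp_all add: inv_into_into f_inv_into_f)
  have "nullity n (nat k) = card (rep ` I)"
  proof (rule nullity_eq_card_transversal[OF k_pos],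
      unfold E_def[symmetric] component_eq_iff[symmetric])
    show "rep ` I \<subseteq> {0..<k}"
      using rep_in_component unfolding G_verts_def I_def by (force simp: order.order_iff_strict)
    show "component E d \<noteq> component E k" if "d \<in> rep ` I" for d
      using that rep_in_component unfolding I_def by auto
    show "d = d'" if "d \<in> rep ` I" "d' \<in> rep ` I" "component E d = component E d'" for d d'
      using that rep_in_component by auto
    show "\<exists>d\<in>rep ` I. component E c = component E d"
      if "c \<in> {0..<k}" "component E c \<noteq> component E k" for c
      using that rep_in_component[of "component E c"]
      unfolding I_def components_def G_verts_def by auto
  qed
  also have "\<dots> = card I"
    using rep_in_component by (intro card_image inj_on_inverseI[of _ "component E"]) auto
  finally have "nullity n (nat k) = card I" .
  moreover have "Suc (card I) = card (components (G_verts k) E)"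
    unfolding I_def using k_pos by (intro card_Suc_Diff1) (auto simp: components_def G_verts_def)
  ultimately show ?thesis unfolding E_def by simp
qed

lemma N_eq_card_components:
  assumes k_pos: "k \<ge> 1"
  shows "N n k + 1 = card (components (G_verts k) (G_edges n k))"
proof -
  let ?n = "n mod (k\<^sup>2 + k) + (k\<^sup>2 + k)"
  have "k\<^sup>2 + k > 0" using k_pos by (simp add: add_nonneg_pos)
  hence "int (nat ?n) = ?n" by (simp add: add_nonneg_nonneg)
  moreover have "?n = n + (k\<^sup>2 + k) * (1 - n div (k\<^sup>2 + k))"
    by (simp add: algebra_simps minus_div_mult_eq_mod[symmetric])
  ultimately have "G_edges (int (nat ?n)) k = G_edges n k"
    by (simp only: G_edges_periodic)
  thus ?thesis
    unfolding N_def using nullity_eq_card_components[OF k_pos, of "nat ?n"] by simp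
qed

lemma N_eq_card_image:
  assumes k_pos: "k \<ge> 1"
    and "\<And>x y. (x, y) \<in> G_edges n k \<Longrightarrow> h x = h y"
    and "\<And>x. x \<in> G_verts k \<Longrightarrow> connected_in (G_edges n k) x (g (h x))"
  shows "N n k + 1 = card (h ` G_verts k)"
  unfolding N_eq_card_components[OF k_pos] using assms(2,3) by (rule card_components_eq)

lemma N_reflection: "k \<ge> 1 \<Longrightarrow> N (- 2 * k - n) k = N n k"
  using N_eq_card_components[of k] card_components_reflection[of k n] by (metis add_right_cancel)

section \<open>Rotations\<close>

text \<open>The vertices are arranged on a circle which is cut into \<open>q\<close> arcs, of length \<open>f + 1\<close> if occupied
  and \<open>f\<close> otherwise; \<open>start x\<close> is the beginning of arc \<open>x\<close>.\<close>
locale rotation =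
  fixes k q j :: int
  assumes q_bounds: "1 \<le> q" "q \<le> k" and coprime_j_q: "coprime j q"
begin

abbreviation "f \<equiv> fq k q"
abbreviation "m \<equiv> mq k q"

definition rho :: "int \<Rightarrow> int" where "rho r = (r * j) mod q"
definition carry :: "int \<Rightarrow> int" where "carry r = ((r + 1) * j) div q - (r * j) div q"
definition occupied :: "int \<Rightarrow> bool" where "occupied x \<longleftrightarrow> x \<in> rho ` {0..m}"
definition occupied_below :: "int \<Rightarrow> int" where
  "occupied_below x = (\<Sum>a\<in>{0..m}. of_bool (rho a < x))"
definition start :: "int \<Rightarrow> int" where "start x = x * f + occupied_below x"
definition turns :: int where "turns = f * j + (m * j) div q"

lemma k_pos: "k \<ge> 1"
  using q_bounds by simp

lemma f_pos: "f \<ge> 1"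
  unfolding fq_def using q_bounds by (simp add: pos_imp_zdiv_pos_iff int_one_le_iff_zero_less)

lemma m_eq_mod: "m = k mod q"
  unfolding mq_def fq_def by (simp add: minus_div_mult_eq_mod)

lemma m_nonneg: "0 \<le> m" and m_less: "m < q"
  unfolding m_eq_mod using q_bounds by auto

lemma k_eq_fq_plus_m: "k = f * q + m"
  unfolding mq_def by simp

lemma f_le_k: "f \<le> k"
proof -
  have "f * 1 \<le> f * q" using f_pos q_bounds by (intro mult_left_mono) auto
  thus ?thesis using k_eq_fq_plus_m m_nonneg by linarith
qed

lemma rho_nonneg: "0 \<le> rho r" and rho_less: "rho r < q"
  unfolding rho_def using q_bounds by auto

lemma rho_0 [simp]: "rho 0 = 0"
  unfolding rho_def by simp

lemma rho_eq_iff: "rho r = rho r' \<longleftrightarrow> r mod q = r' mod q"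
proof -
  have "rho r = rho r' \<longleftrightarrow> q dvd (r - r') * j"
    unfolding rho_def by (simp add: mod_eq_dvd_iff left_diff_distrib)
  also have "\<dots> \<longleftrightarrow> q dvd r - r'"
    using coprime_j_q by (simp add: coprime_dvd_mult_left_iff coprime_commute)
  finally show ?thesis by (simp add: mod_eq_dvd_iff)
qed

lemma inj_on_rho: "inj_on rho {0..<q}"
  by (rule inj_onI) (simp add: rho_eq_iff)

lemma rho_surj:
  assumes "0 \<le> x" "x < q"
  obtains r where "0 \<le> r" "r < q" "rho r = x"
proof -
  have "rho ` {0..<q} = {0..<q}"
    using inj_on_rho rho_nonneg rho_less by (intro endo_inj_surj) auto
  hence "x \<in> rho ` {0..<q}" using assms by simp
  thus ?thesis using that by auto
qed

lemma rho_pos_iff: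
  assumes "0 \<le> r" "r < q"
  shows "0 < rho r \<longleftrightarrow> r \<noteq> 0"
  using rho_eq_iff[of r 0] rho_nonneg[of r] assms by (auto simp: order.order_iff_strict)

lemma rho_Suc: "rho (r + 1) = rho r + j - q * carry r"
  unfolding rho_def carry_def by (simp add: minus_mult_div_eq_mod[symmetric] algebra_simps)

lemma sum_carry: "M \<ge> 0 \<Longrightarrow> (\<Sum>a\<in>{0..<M}. carry a) = (M * j) div q"
proof (induction M rule: int_ge_induct)
  case (step M)
  have "{0..<M + 1} = insert M {0..<M}" using step by auto
  thus ?case using step by (simp add: carry_def)
qed simp

lemma occupied_rho: "occupied (rho r) \<longleftrightarrow> r mod q \<le> m"
proof
  assume "occupied (rho r)"
  then obtain a where "0 \<le> a" "a \<le> m" "rho r = rho a" unfolding occupied_def by auto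
  thus "r mod q \<le> m" using m_less unfolding rho_eq_iff by simp
next
  assume "r mod q \<le> m"
  moreover have "rho r = rho (r mod q)" unfolding rho_eq_iff by simp
  ultimately show "occupied (rho r)" unfolding occupied_def using q_bounds by auto
qed

lemma occupied_rho_m: "occupied (rho m)"
  unfolding occupied_def using m_nonneg by auto

lemma occupied_0: "occupied 0"
  unfolding occupied_def using m_nonneg by (auto intro: rev_image_eqI)

lemma sum_of_bool_rho_eq: "(\<Sum>a\<in>{0..m}. of_bool (rho a = x)) = (of_bool (occupied x) :: int)"
proof -
  have "inj_on rho {0..m}"
    using inj_on_rho by (rule inj_on_subset) (use m_less in auto)
  hence "(\<Sum>a\<in>{0..m}. of_bool (rho a = x)) = (\<Sum>y\<in>rho ` {0..m}. of_bool (y = x) :: int)"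
    by (simp only: sum.reindex comp_def)
  also have "\<dots> = of_bool (occupied x)"
    unfolding occupied_def of_bool_def
    by (simp only: sum.delta finite_imageI finite_atLeastAtMost_int)
  finally show ?thesis .
qed

lemma occupied_below_0 [simp]: "occupied_below 0 = 0"
  unfolding occupied_below_def using rho_nonneg by (intro sum.neutral) (auto simp: not_less)

lemma occupied_below_Suc: "occupied_below (x + 1) = occupied_below x + of_bool (occupied x)"
  unfolding occupied_below_def sum_of_bool_rho_eq[symmetric] sum.distrib[symmetric]
  by (intro sum.cong) auto

lemma start_0 [simp]: "start 0 = 0"
  unfolding start_def by simp

lemma start_q: "start q = k + 1"
proof -
  have "occupied_below q = m + 1" unfolding occupied_below_def using rho_less m_nonneg by simp
  thus ?thesis unfolding start_def using k_eq_fq_plus_m by (simp add: algebra_simps)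
qed

lemma start_Suc: "start (x + 1) = start x + f + of_bool (occupied x)"
  unfolding start_def occupied_below_Suc by (simp add: algebra_simps)

lemma start_mono: "x \<le> y \<Longrightarrow> start x \<le> start y"
  unfolding start_def occupied_below_def using f_pos
  by (intro add_mono mult_right_mono sum_mono) auto

lemma start_less: "x < y \<Longrightarrow> start x + f + of_bool (occupied x) \<le> start y"
  using start_mono[of "x + 1" y] start_Suc[of x] by simp

lemma start_rho_nonneg: "0 \<le> start (rho r)"
  using start_mono[OF rho_nonneg] by simp

lemma start_rho_le: "start (rho r) + f + of_bool (occupied (rho r)) \<le> k + 1"
  using start_less[OF rho_less] by (simp add: start_q)

lemma of_bool_rho_Suc_less:
  "of_bool (rho (a + 1) < rho (r + 1)) = of_bool (rho a < rho r) + carry a - carry r"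
proof -
  define c where "c = carry a - carry r"
  have diff: "rho (a + 1) - rho (r + 1) = rho a - rho r - q * c"
    unfolding rho_Suc c_def by (simp add: algebra_simps)
  hence "\<bar>q * c\<bar> < q * 2"
    using rho_nonneg[of a] rho_less[of a] rho_nonneg[of r] rho_less[of r]
      rho_nonneg[of "a + 1"] rho_less[of "a + 1"] rho_nonneg[of "r + 1"] rho_less[of "r + 1"]
    by linarith
  hence "\<bar>c\<bar> < 2" using q_bounds by (simp add: abs_mult)
  hence "c = - 1 \<or> c = 0 \<or> c = 1" by linarith
  thus ?thesis
    using diff rho_nonneg[of a] rho_less[of a] rho_nonneg[of r] rho_less[of r]
      rho_nonneg[of "a + 1"] rho_less[of "a + 1"] rho_nonneg[of "r + 1"] rho_less[of "r + 1"]
    unfolding c_def[symmetric] add_diff_eq[symmetric] by (elim disjE) auto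
qed

lemma occupied_below_rho_Suc:
  "occupied_below (rho (r + 1)) = occupied_below (rho r) + (m * j) div q - m * carry r
    + of_bool (0 < rho (r + 1)) - of_bool (rho m < rho r)"
proof -
  have first: "{0..m} = insert 0 ((\<lambda>a. a + 1) ` {0..<m})"
    using m_nonneg by (auto simp: image_iff intro: bexI[of _ "_ - 1"])
  have last: "{0..m} = insert m {0..<m}"
    using m_nonneg by auto
  have "occupied_below (rho (r + 1)) =
      of_bool (0 < rho (r + 1)) + (\<Sum>a\<in>{0..<m}. of_bool (rho (a + 1) < rho (r + 1)))"
    unfolding occupied_below_def first
    by (subst sum.insert)
      (auto simp: sum.reindex comp_def simp del: sum_of_bool_eq image_add_atLeastLessThan')
  also have "(\<Sum>a\<in>{0..<m}. of_bool (rho (a + 1) < rho (r + 1))) =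
      (\<Sum>a\<in>{0..<m}. of_bool (rho a < rho r)) + (m * j) div q - m * carry r"
    using m_nonneg unfolding of_bool_rho_Suc_less
    by (simp add: sum_subtractf sum.distrib sum_carry del: sum_of_bool_eq)
  also have "(\<Sum>a\<in>{0..<m}. of_bool (rho a < rho r)) =
      occupied_below (rho r) - of_bool (rho m < rho r)"
    unfolding occupied_below_def last by (simp del: sum_of_bool_eq)
  finally show ?thesis by simp
qed

lemma start_rho_Suc:
  "start (rho (r + 1)) = start (rho r) + turns - k * carry r
    + of_bool (0 < rho (r + 1)) - of_bool (rho m < rho r)"
proof -
  have "rho (r + 1) * f = rho r * f + f * j - (f * q) * carry r"
    unfolding rho_Suc by (simp add: algebra_simps)
  moreover have "(f * q) * carry r + m * carry r = k * carry r"
    using k_eq_fq_plus_m by (metis distrib_right)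
  ultimately show ?thesis
    unfolding start_def occupied_below_rho_Suc turns_def by simp
qed

lemma s_fun_eq_occupied_below:
  "s_fun k q j = occupied_below (rho (m + 1)) - of_bool (0 < rho (m + 1))"
proof -
  have "rho a \<noteq> rho (m + 1)" if "1 \<le> a" "a \<le> m" for a
  proof
    assume "rho a = rho (m + 1)"
    hence "a = m + 1"
      using that m_less mod_eq_imp_eq_in_window[of a q "m + 1" 1] unfolding rho_eq_iff by simp
    thus False using that by simp
  qed
  hence le_iff: "rho a \<le> rho (m + 1) \<longleftrightarrow> rho a < rho (m + 1)" if "a \<in> {1..m}" for a
    using that by (simp add: order.order_iff_strict)
  have "s_fun k q j = (\<Sum>a\<in>{1..m}. of_bool (rho a \<le> rho (m + 1)))"
    unfolding s_fun_def Mq_def rho_def[symmetric] by (simp add: sum_of_bool_eq Int_def)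
  also have "\<dots> = (\<Sum>a\<in>{1..m}. of_bool (rho a < rho (m + 1)))"
    by (intro sum.cong refl) (simp only: le_iff)
  also have "\<dots> = occupied_below (rho (m + 1)) - of_bool (0 < rho (m + 1))"
  proof -
    have "{0..m} = insert 0 {1..m}" using m_nonneg by auto
    thus ?thesis unfolding occupied_below_def by (simp del: sum_of_bool_eq)
  qed
  finally show ?thesis .
qed

lemma eta_eq_start_Suc_m:
  "eta k q j = k * (((k + 1) * j) div q - 1) + start (rho (m + 1)) - of_bool (0 < rho (m + 1))"
  unfolding eta_def Mq_def rho_def[symmetric] s_fun_eq_occupied_below start_def
  by (simp add: algebra_simps)

lemma eta_eq_start_m: "eta k q j = (k + 1) * turns - k + start (rho m)"
proof -
  have "(k + 1) * j = (m + 1) * j + q * (f * j)"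
    using k_eq_fq_plus_m
    by (metis add.commute add.left_commute distrib_right mult.assoc mult.commute)
  hence "((k + 1) * j) div q = f * j + ((m + 1) * j) div q" using q_bounds by simp
  hence "((k + 1) * j) div q = turns + carry m" unfolding turns_def carry_def by simp
  thus ?thesis
    unfolding eta_eq_start_Suc_m start_rho_Suc[of m] by (simp add: algebra_simps)
qed

end

context rotation
begin

lemma rotation_opposite: "rotation k q (- j)"
  by unfold_locales (use q_bounds coprime_j_q in auto)

interpretation opposite: rotation k q "- j"
  by (rule rotation_opposite)

lemma opposite_rho: "opposite.rho r = (if rho r = 0 then 0 else q - rho r)"
  unfolding opposite.rho_def rho_def by (simp add: zmod_zminus1_eq_if)

lemma opposite_start:
  assumes "0 < x" "x < q"
  shows "opposite.start (q - x) + start x + of_bool (occupied x) = k + 2"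
proof -
  have "opposite.occupied_below (q - x) + occupied_below x + of_bool (occupied x) =
      (\<Sum>a\<in>{0..m}. of_bool (opposite.rho a < q - x) + of_bool (rho a < x) + of_bool (rho a = x))"
    unfolding opposite.occupied_below_def occupied_below_def
      sum_of_bool_rho_eq[symmetric] sum.distrib ..
  also have "\<dots> = (\<Sum>a\<in>{0..m}. 1 + (if a = 0 then 1 else 0))"
  proof (intro sum.cong refl)
    fix a assume "a \<in> {0..m}"
    hence "rho a = 0 \<longleftrightarrow> a = 0" using rho_pos_iff[of a] m_less by auto
    thus "of_bool (opposite.rho a < q - x) + of_bool (rho a < x) + of_bool (rho a = x) =
        1 + (if a = 0 then 1 else 0 :: int)"
      unfolding opposite_rho using assms by (cases "a = 0") auto
  qed
  also have "\<dots> = m + 2" using m_nonneg by (simp add: sum.distrib)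
  finally show ?thesis
    unfolding start_def opposite.start_def using k_eq_fq_plus_m by (simp add: algebra_simps)
qed

lemma eta_opposite: "eta k q (- j) = - 2 * k - eta k q j"
proof (cases "m = 0")
  case True
  thus ?thesis
    unfolding eta_eq_start_m opposite.eta_eq_start_m turns_def opposite.turns_def by (simp add: algebra_simps)
next
  case False
  hence rho_m_pos: "0 < rho m" using rho_pos_iff[of m] m_nonneg m_less by simp
  have "(m * - j) div q = - ((m * j) div q) - 1"
    using rho_m_pos q_bounds unfolding rho_def by (simp add: zdiv_zminus1_eq_if)
  hence turns: "opposite.turns = - turns - 1"
    unfolding turns_def opposite.turns_def by simp
  have "opposite.start (opposite.rho m) + start (rho m) = k + 1"
    using opposite_start[OF rho_m_pos rho_less] occupied_rho_m rho_m_pos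
    unfolding opposite_rho by simp
  thus ?thesis
    unfolding eta_eq_start_m opposite.eta_eq_start_m turns by (simp add: algebra_simps)
qed

end

section \<open>The vertices along the strands\<close>

context rotation
begin

text \<open>\<open>vertex r w\<close> is the vertex at step \<open>r\<close> of the cycle \<open>w\<close>; \<open>w = 0\<close> encodes the path,
  which only has the steps \<open>0, \<dots>, m\<close>.\<close>
definition vertex :: "int \<Rightarrow> int \<Rightarrow> int" where
  "vertex r w = (start (rho r) - 1 - w) mod (k + 1)"

definition present :: "int \<Rightarrow> int \<Rightarrow> bool" where
  "present r w \<longleftrightarrow> 1 - of_bool (occupied (rho r)) \<le> w \<and> w \<le> f"

definition has_next :: "int \<Rightarrow> int \<Rightarrow> bool" where
  "has_next r w \<longleftrightarrow> present r w \<and> (w = 0 \<longrightarrow> rho r \<noteq> rho m)"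

lemma present_nonneg: "present r w \<Longrightarrow> 0 \<le> w" and present_le_f: "present r w \<Longrightarrow> w \<le> f"
  unfolding present_def by (auto simp: of_bool_def split: if_splits)

lemma present_0_iff: "present r 0 \<longleftrightarrow> occupied (rho r)"
  unfolding present_def using f_pos by (auto simp: of_bool_def split: if_splits)

lemma present_0_0: "present 0 0"
  unfolding present_0_iff by (simp add: occupied_0)

lemma has_next_if_pos: "1 \<le> w \<Longrightarrow> w \<le> f \<Longrightarrow> has_next r w"
  unfolding has_next_def present_def by (auto simp: of_bool_def)

lemma present_if_pos: "1 \<le> w \<Longrightarrow> w \<le> f \<Longrightarrow> present r w"
  using has_next_if_pos unfolding has_next_def by blast

lemma present_start_bounds:
  assumes "present r w"
  shows "- 1 - f \<le> start (rho r) - 1 - w" and "start (rho r) - 1 - w < k - f"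
  using assms start_rho_nonneg[of r] start_rho_le[of r] unfolding present_def by auto

lemma vertex_cong: "rho r = rho r' \<Longrightarrow> vertex r w = vertex r' w"
  unfolding vertex_def by simp

lemma vertex_inj:
  assumes "present r w" "present r' w'" "vertex r w = vertex r' w'"
  shows "rho r = rho r'" and "w = w'"
proof -
  have start_eq: "start (rho r) - 1 - w = start (rho r') - 1 - w'"
    using assms(3) present_start_bounds[OF assms(1)] present_start_bounds[OF assms(2)]
      mod_eq_imp_eq_in_window[where p = "k + 1" and a = "- 1 - f"]
    unfolding vertex_def by simp
  show "rho r = rho r'"
  proof (rule linorder_cases[of "rho r" "rho r'"])
    assume "rho r < rho r'"
    from start_less[OF this] show ?thesis using assms(1,2) start_eq unfolding present_def by auto
  next
    assume "rho r' < rho r"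
    from start_less[OF this] show ?thesis using assms(1,2) start_eq unfolding present_def by auto
  qed
  with start_eq show "w = w'" by simp
qed

lemma vertex_rho_0:
  assumes "rho r = 0" "0 \<le> w" "w \<le> k"
  shows "vertex r w = k - w"
proof -
  have "vertex r w = (k - w + - 1 * (k + 1)) mod (k + 1)"
    unfolding vertex_def by (simp add: assms(1) algebra_simps)
  also have "\<dots> = (k - w) mod (k + 1)" by (rule mod_mult_self1)
  finally show ?thesis using assms(2,3) by simp
qed

lemma vertex_rho_pos:
  assumes "present r w" "0 < rho r"
  shows "vertex r w = start (rho r) - 1 - w" and "0 \<le> vertex r w" and "vertex r w < k"
proof -
  have "0 \<le> start (rho r) - 1 - w"
    using start_less[OF assms(2)] occupied_0 present_le_f[OF assms(1)] by simp
  moreover have "start (rho r) - 1 - w < k"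
    using present_start_bounds(2)[OF assms(1)] f_pos by simp
  ultimately show "vertex r w = start (rho r) - 1 - w" "0 \<le> vertex r w" "vertex r w < k"
    unfolding vertex_def by auto
qed

lemma arc_exists:
  assumes "0 \<le> z" "z \<le> k"
  shows "\<exists>v. 0 \<le> v \<and> v < q \<and> start v \<le> z \<and> z < start (v + 1)"
proof (rule ccontr)
  assume no_arc: "\<not> ?thesis"
  have "start v \<le> z" if "0 \<le> v" "v \<le> q" for v
    using that
  proof (induction v rule: int_ge_induct)
    case (step v)
    thus ?case using no_arc by force
  qed (use assms in simp)
  from this[of q] show False using assms q_bounds start_q by simp
qed

lemma vertex_surj:
  assumes "x \<in> G_verts k"
  obtains r w where "0 \<le> r" "r < q" "present r w" "x = vertex r w"
proof -
  define z where "z = (x + 1 + f) mod (k + 1)"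
  have "0 \<le> z" "z \<le> k"
    using k_pos pos_mod_bound[of "k + 1" "x + 1 + f"] unfolding z_def by auto
  then obtain v where v_arc: "0 \<le> v" "v < q" "start v \<le> z" "z < start (v + 1)"
    using arc_exists by blast
  obtain r where rho_r: "0 \<le> r" "r < q" "rho r = v" using rho_surj v_arc by blast
  define w where "w = start v + f - z"
  have "present r w"
    using v_arc start_Suc[of v] unfolding present_def w_def rho_r(3) by simp
  moreover have "vertex r w = x"
  proof -
    have "vertex r w = (z - (1 + f)) mod (k + 1)"
      unfolding vertex_def rho_r(3) w_def by (simp add: algebra_simps)
    also have "\<dots> = x mod (k + 1)" unfolding z_def by (simp add: mod_diff_left_eq)
    finally show ?thesis using assms unfolding G_verts_def by simp
  qed
  ultimately show ?thesis using that rho_r by blast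
qed

lemma has_next_Suc:
  assumes "has_next r w"
  shows "present (r + 1) w" and "w = 0 \<Longrightarrow> 0 < rho (r + 1)"
proof -
  have next_0: "0 < rho (r + 1)" "occupied (rho (r + 1))" if "w = 0"
  proof -
    define a where "a = r mod q"
    have "rho r = rho a" and rho_Suc_r: "rho (r + 1) = rho (a + 1)"
      unfolding rho_eq_iff a_def by (simp_all add: mod_add_left_eq)
    moreover have "a \<le> m"
      using assms that unfolding has_next_def a_def by (simp add: present_0_iff occupied_rho)
    ultimately have "a < m"
      using assms that unfolding has_next_def by (auto simp: order.order_iff_strict)
    moreover have "0 \<le> a" unfolding a_def using q_bounds by simp
    ultimately show "0 < rho (r + 1)" "occupied (rho (r + 1))"
      unfolding rho_Suc_r using rho_pos_iff[of "a + 1"] m_less by (simp_all add: occupied_rho)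
  qed
  thus "present (r + 1) w"
    using assms present_0_iff[of "r + 1"] present_if_pos[of w "r + 1"] present_nonneg[of r w]
      present_le_f[of r w] unfolding has_next_def by (cases "w = 0") auto
  show "w = 0 \<Longrightarrow> 0 < rho (r + 1)" by (rule next_0)
qed

section \<open>The edges at a peak\<close>

definition edge_index :: "int \<Rightarrow> int \<Rightarrow> int" where
  "edge_index r w = start (rho r) - 1 - w + (k + 1) * (turns - of_bool (rho m < rho r))"

lemma edge_index_mod: "edge_index r w mod (k + 1) = vertex r w"
  unfolding edge_index_def vertex_def by (rule mod_mult_self2)

lemma edge_index_in_window:
  assumes "has_next r w"
  shows "eta k q j - 1 \<le> edge_index r w" and "edge_index r w < eta k q j - 1 + k"
proof -
  have present: "present r w" using assms unfolding has_next_def by simp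
  have "eta k q j - 1 \<le> edge_index r w \<and> edge_index r w < eta k q j - 1 + k"
  proof (cases "rho m < rho r")
    case True
    have "start (rho m) + f + 1 \<le> start (rho r)"
      using start_less[OF True] occupied_rho_m by simp
    thus ?thesis
      using True present_le_f[OF present] present_start_bounds(2)[OF present] f_pos
        start_rho_nonneg[of m]
      unfolding edge_index_def eta_eq_start_m by (simp add: algebra_simps)
  next
    case False
    have "start (rho r) - w < start (rho m)"
    proof (cases "rho r = rho m")
      case True
      thus ?thesis using assms present_nonneg[OF present] unfolding has_next_def by force
    next
      case distinct: False
      thus ?thesis using start_less[of "rho r" "rho m"] False present f_pos
        unfolding present_def by (simp add: of_bool_def split: if_splits)
    qed
    thus ?thesis
      using False present_le_f[OF present] start_rho_le[of m] occupied_rho_m start_rho_nonneg[of r]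
      unfolding edge_index_def eta_eq_start_m by (simp add: algebra_simps)
  qed
  thus "eta k q j - 1 \<le> edge_index r w" "edge_index r w < eta k q j - 1 + k" by auto
qed

lemma edge_edge_index:
  assumes "has_next r w"
  shows "edge k (edge_index r w) = (vertex r w, vertex (r + 1) w)"
proof -
  note present_Suc = has_next_Suc(1)[OF assms]
  have "(edge_index r w + 1) mod k = vertex (r + 1) w"
  proof (cases "0 < rho (r + 1)")
    case True
    have "edge_index r w + 1 = vertex (r + 1) w + k * (turns - of_bool (rho m < rho r) + carry r)"
      using True unfolding edge_index_def vertex_rho_pos(1)[OF present_Suc True] start_rho_Suc
      by (simp add: algebra_simps)
    thus ?thesis
      using vertex_rho_pos(2,3)[OF present_Suc True] by (metis mod_mult_self2 mod_pos_pos_trivial)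
  next
    case False
    hence zero: "rho (r + 1) = 0" using rho_nonneg[of "r + 1"] by simp
    have w_bounds: "0 < w" "w \<le> k"
      using has_next_Suc(2)[OF assms] False present_nonneg[OF present_Suc]
        present_le_f[OF present_Suc] f_le_k
      by (auto simp: order.order_iff_strict)
    have "edge_index r w + 1 = k - w + k * (turns - of_bool (rho m < rho r) + carry r - 1)"
      using start_rho_Suc[of r] zero unfolding edge_index_def by (simp add: algebra_simps)
    moreover have "0 \<le> k - w" "k - w < k" using w_bounds by auto
    ultimately show ?thesis
      using vertex_rho_0[OF zero, of w] w_bounds
      by (metis less_imp_le mod_mult_self2 mod_pos_pos_trivial)
  qed
  thus ?thesis unfolding edge_def edge_index_mod by simp
qed

lemma edge_index_exhaust:
  assumes "eta k q j - 1 \<le> e" "e < eta k q j - 1 + k"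
  obtains r w where "has_next r w" "e = edge_index r w"
proof -
  have "e mod (k + 1) \<in> G_verts k"
    using k_pos pos_mod_bound[of "k + 1" e] unfolding G_verts_def by simp
  then obtain r w where vertex_r: "present r w" "e mod (k + 1) = vertex r w"
    using vertex_surj by metis
  have "has_next r w"
  proof (rule ccontr)
    assume "\<not> has_next r w"
    hence "e mod (k + 1) = vertex m 0"
      using vertex_r vertex_cong unfolding has_next_def by metis
    also have "\<dots> = (eta k q j - 2) mod (k + 1)"
    proof -
      have "eta k q j - 2 = start (rho m) - 1 - 0 + (k + 1) * (turns - 1)"
        unfolding eta_eq_start_m by (simp add: algebra_simps)
      thus ?thesis unfolding vertex_def by (metis mod_mult_self2)
    qed
    finally have "e = eta k q j - 2"
      using assms mod_eq_imp_eq_in_window[of e "k + 1" "eta k q j - 2" "eta k q j - 2"] by simp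
    thus False using assms by simp
  qed
  moreover from this have "e = edge_index r w"
    using assms edge_index_in_window[of r w] vertex_r(2) edge_index_mod[of r w]
      mod_eq_imp_eq_in_window[of e "k + 1" "edge_index r w" "eta k q j - 1"] by simp
  ultimately show ?thesis using that by blast
qed

lemma in_eta_window_iff:
  "e \<in> {eta k q j - 1..<eta k q j - 1 + k} \<longleftrightarrow> (\<exists>r w. has_next r w \<and> e = edge_index r w)"
  using edge_index_in_window edge_index_exhaust unfolding atLeastLessThan_iff by metis

lemma G_edges_eta: "(x, y) \<in> G_edges (eta k q j) k \<longleftrightarrow>
    (\<exists>r w. has_next r w \<and> x = vertex r w \<and> y = vertex (r + 1) w)"
proof -
  have "(x, y) \<in> G_edges (eta k q j) k \<longleftrightarrow> (\<exists>r w. has_next r w \<and> (x, y) = edge k (edge_index r w))"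
    unfolding G_edges_eq_image_edge image_iff Bex_def in_eta_window_iff by blast
  thus ?thesis by (simp add: edge_edge_index cong: conj_cong)
qed

end

section \<open>The nullity near a peak\<close>

context rotation
begin

lemma connected_around_cycle:
  assumes "\<And>r. rho r \<noteq> rho s \<Longrightarrow> connected_in E (vertex r w) (vertex (r + 1) w)"
  shows "connected_in E (vertex (s + 1) w) (vertex r w)"
proof -
  have "connected_in E (vertex (s + 1) w) (vertex (s + 1 + i) w)" if "0 \<le> i" "i < q" for i
    using that
  proof (induction i rule: int_ge_induct)
    case (step i)
    have "rho (s + 1 + i) \<noteq> rho s"
    proof
      assume "rho (s + 1 + i) = rho s"
      hence "(s + 1 + i) mod q = s mod q" unfolding rho_eq_iff .
      thus False using mod_eq_imp_eq_in_window[of "s + 1 + i" q s s] step by simp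
    qed
    from assms[OF this] step show ?case
      by (auto intro: equivclp_trans simp: add.assoc)
  qed simp
  from this[of "(r - (s + 1)) mod q"]
  have "connected_in E (vertex (s + 1) w) (vertex (s + 1 + (r - (s + 1)) mod q) w)"
    using q_bounds by simp
  moreover have "rho (s + 1 + (r - (s + 1)) mod q) = rho r"
    unfolding rho_eq_iff by (simp add: mod_add_right_eq)
  ultimately show ?thesis by (metis vertex_cong)
qed

definition strand :: "int \<Rightarrow> int" where
  "strand x = (THE w. \<exists>r. present r w \<and> x = vertex r w)"

lemma strand_vertex: "present r w \<Longrightarrow> strand (vertex r w) = w"
  unfolding strand_def using vertex_inj(2) by (intro the_equality) blast+

end

text \<open>The shift by \<open>d\<close> cuts the cycles \<open>f, f - 1, \<dots>, f - d + 1\<close> at the step \<open>s\<close>, whose arc follows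
  the one of the end of the path, and splices them one after the other to the path.\<close>
locale shifted_rotation = rotation +
  fixes s d :: int
  assumes rho_s: "rho s = (rho m + 1) mod q" and d_bounds: "0 \<le> d" "d \<le> f"
begin

abbreviation "E \<equiv> G_edges (eta k q j + d) k"

definition splice_source :: "int \<Rightarrow> int" where
  "splice_source w = (if w = f then vertex m 0 else vertex s (w + 1))"

lemma edge_index_s:
  assumes "1 \<le> w" "w \<le> f"
  shows "edge_index s w = eta k q j - 1 + (f - w)"
proof (cases "rho m + 1 = q")
  case True
  moreover from this have "rho s = 0" using rho_s by simp
  moreover have "start (rho m) = k - f"
    using start_Suc[of "rho m"] occupied_rho_m start_q True by simp
  ultimately show ?thesis
    unfolding edge_index_def eta_eq_start_m using rho_nonneg[of m] by (simp add: algebra_simps)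
next
  case False
  hence "rho s = rho m + 1" using rho_s rho_less[of m] rho_nonneg[of m] by simp
  thus ?thesis
    unfolding edge_index_def eta_eq_start_m
    using start_Suc[of "rho m"] occupied_rho_m by (simp add: algebra_simps)
qed

lemma edge_index_s_image: "edge_index s ` {f - d<..f} = {eta k q j - 1..<eta k q j - 1 + d}"
proof -
  have "edge_index s ` {f - d<..f} = (\<lambda>w. eta k q j - 1 + f - w) ` {f - d<..f}"
    using d_bounds by (intro image_cong refl) (simp add: edge_index_s)
  also have "\<dots> = {eta k q j - 1..<eta k q j - 1 + d}"
    by (auto simp: image_iff intro: bexI[of _ "eta k q j - 1 + f - _"])
  finally show ?thesis .
qed

lemma splice_source_eq:
  assumes "1 \<le> w" "w \<le> f"
  shows "splice_source w = (edge_index s w - 1) mod (k + 1)"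
proof (cases "w = f")
  case True
  have "edge_index s w - 1 = start (rho m) - 1 - 0 + (k + 1) * (turns - 1)"
    unfolding edge_index_s[OF assms] eta_eq_start_m using True by (simp add: algebra_simps)
  thus ?thesis unfolding splice_source_def vertex_def using True by (metis mod_mult_self2)
next
  case False
  hence "edge_index s w - 1 = edge_index s (w + 1)"
    using assms edge_index_s[of w] edge_index_s[of "w + 1"] by simp
  thus ?thesis unfolding splice_source_def using False by (simp add: edge_index_mod)
qed

lemma edge_index_unshifted_iff:
  assumes "has_next r w"
  shows "eta k q j - 1 + d \<le> edge_index r w \<longleftrightarrow> \<not> (rho r = rho s \<and> f - d < w)"
proof
  assume "eta k q j - 1 + d \<le> edge_index r w"
  moreover have "edge_index r w = edge_index s w" if "rho r = rho s"
    unfolding edge_index_def that ..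
  ultimately show "\<not> (rho r = rho s \<and> f - d < w)"
    using edge_index_s[of w] d_bounds assms present_le_f unfolding has_next_def by auto
next
  assume kept: "\<not> (rho r = rho s \<and> f - d < w)"
  show "eta k q j - 1 + d \<le> edge_index r w"
  proof (rule ccontr)
    define v where "v = f - (edge_index r w - (eta k q j - 1))"
    assume "\<not> ?thesis"
    hence v_bounds: "f - d < v" "v \<le> f"
      using edge_index_in_window(1)[OF assms] unfolding v_def by simp_all
    hence "edge_index r w = edge_index s v"
      using edge_index_s[of v] d_bounds unfolding v_def by simp
    hence "vertex r w = vertex s v" by (metis edge_index_mod)
    moreover have "present r w" "present s v"
      using assms v_bounds d_bounds present_if_pos unfolding has_next_def by simp_all
    ultimately show False using vertex_inj[of r w s v] kept v_bounds by simp
  qed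
qed

lemma G_edges_shifted:
  "(x, y) \<in> E \<longleftrightarrow>
    (\<exists>r w. has_next r w \<and> \<not> (rho r = rho s \<and> f - d < w) \<and> x = vertex r w \<and> y = vertex (r + 1) w) \<or>
    (\<exists>w. f - d < w \<and> w \<le> f \<and> x = splice_source w \<and> y = vertex (s + 1) w)"
proof -
  let ?moved = "\<lambda>e. ((e - 1) mod (k + 1), (e + 1) mod k)"
  have "(x, y) \<in> edge k ` {eta k q j - 1 + d..<eta k q j - 1 + k} \<longleftrightarrow>
      (\<exists>e\<in>{eta k q j - 1..<eta k q j - 1 + k}. eta k q j - 1 + d \<le> e \<and> (x, y) = edge k e)"
    using d_bounds by auto
  also have "\<dots> \<longleftrightarrow> (\<exists>r w. has_next r w \<and> \<not> (rho r = rho s \<and> f - d < w) \<and>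
      (x, y) = edge k (edge_index r w))"
    unfolding Bex_def in_eta_window_iff using edge_index_unshifted_iff by blast
  also have "\<dots> \<longleftrightarrow> (\<exists>r w. has_next r w \<and> \<not> (rho r = rho s \<and> f - d < w) \<and>
      x = vertex r w \<and> y = vertex (r + 1) w)"
    by (simp add: edge_edge_index cong: conj_cong)
  finally have kept: "(x, y) \<in> edge k ` {eta k q j - 1 + d..<eta k q j - 1 + k} \<longleftrightarrow>
      (\<exists>r w. has_next r w \<and> \<not> (rho r = rho s \<and> f - d < w) \<and> x = vertex r w \<and> y = vertex (r + 1) w)" .
  have "?moved (edge_index s w) = (splice_source w, vertex (s + 1) w)"
    if "f - d < w" "w \<le> f" for w
    using that d_bounds splice_source_eq[of w] edge_edge_index[OF has_next_if_pos, of w s]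
    unfolding edge_def by simp
  hence "(x, y) \<in> ?moved ` {eta k q j - 1..<eta k q j - 1 + d} \<longleftrightarrow>
      (\<exists>w\<in>{f - d<..f}. (x, y) = (splice_source w, vertex (s + 1) w))"
    unfolding edge_index_s_image[symmetric] by (auto simp: image_image image_iff)
  thus ?thesis
    unfolding G_edges_shift[OF d_bounds(1) order_trans[OF d_bounds(2) f_le_k]] Un_iff kept by auto
qed

lemma connected_kept:
  assumes "has_next r w" "\<not> (rho r = rho s \<and> f - d < w)"
  shows "connected_in E (vertex r w) (vertex (r + 1) w)"
  using assms G_edges_shifted by blast

lemma connected_path:
  assumes "0 \<le> a" "a \<le> m"
  shows "connected_in E (vertex 0 0) (vertex a 0)"
  using assms
proof (induction a rule: int_ge_induct)
  case (step a)
  hence "rho a \<noteq> rho m" "present a 0"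
    using m_less inj_onD[OF inj_on_rho, of a m] unfolding present_0_iff occupied_rho by auto
  hence "connected_in E (vertex a 0) (vertex (a + 1) 0)"
    using d_bounds by (intro connected_kept) (simp_all add: has_next_def)
  with step show ?case by (auto intro: equivclp_trans)
qed simp

lemma connected_spliced:
  assumes "f - d < w" "w \<le> f"
  shows "connected_in E (vertex 0 0) (vertex r w)"
proof -
  have around: "connected_in E (vertex (s + 1) v) (vertex r v)" if "f - d < v" "v \<le> f" for r v
    using that d_bounds by (intro connected_around_cycle connected_kept has_next_if_pos) auto
  have splice: "connected_in E (splice_source v) (vertex (s + 1) v)" if "f - d < v" "v \<le> f" for v
    using that G_edges_shifted by blast
  have "\<forall>r. connected_in E (vertex 0 0) (vertex r (f - i))" if "0 \<le> i" "i < d" for i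
    using that
  proof (induction i rule: int_ge_induct)
    case base
    have "connected_in E (vertex 0 0) (splice_source f)"
      unfolding splice_source_def using connected_path m_nonneg by simp
    thus ?case using splice[of f] around[of f] base by (auto intro: equivclp_trans)
  next
    case (step i)
    have "connected_in E (vertex 0 0) (splice_source (f - (i + 1)))"
      unfolding splice_source_def using step by simp
    thus ?case
      using splice[of "f - (i + 1)"] around[of "f - (i + 1)"] step by (auto intro: equivclp_trans)
  qed
  from this[of "f - w"] assms show ?thesis by simp
qed

definition spliced_strand :: "int \<Rightarrow> int" where
  "spliced_strand x = (if f - d < strand x then 0 else strand x)"

lemma spliced_strand_vertex:
  "present r w \<Longrightarrow> spliced_strand (vertex r w) = (if f - d < w then 0 else w)"
  unfolding spliced_strand_def by (simp add: strand_vertex)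

lemma spliced_strand_edge:
  assumes "(x, y) \<in> E"
  shows "spliced_strand x = spliced_strand y"
proof -
  consider (kept) r w where "has_next r w" "x = vertex r w" "y = vertex (r + 1) w"
    | (moved) w where "f - d < w" "w \<le> f" "x = splice_source w" "y = vertex (s + 1) w"
    using assms unfolding G_edges_shifted by blast
  thus ?thesis
  proof cases
    case kept
    thus ?thesis
      using has_next_Suc(1)[OF kept(1)] by (simp add: spliced_strand_vertex has_next_def)
  next
    case moved
    have "present m 0" unfolding present_0_iff by (rule occupied_rho_m)
    hence "spliced_strand x = 0"
      using moved d_bounds present_if_pos[of "w + 1" s] unfolding splice_source_def
      by (auto simp: spliced_strand_vertex)
    thus ?thesis
      using moved d_bounds present_if_pos[of w "s + 1"] by (simp add: spliced_strand_vertex)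
  qed
qed

lemma connected_strand_origin:
  assumes "x \<in> G_verts k"
  shows "connected_in E x (vertex 0 (spliced_strand x))"
proof -
  obtain r w where x_vertex: "0 \<le> r" "r < q" "present r w" "x = vertex r w"
    using vertex_surj[OF assms] .
  consider (path) "w = 0" | (intact) "1 \<le> w" "w \<le> f - d" | (spliced) "f - d < w" "w \<le> f"
    using present_nonneg[OF x_vertex(3)] present_le_f[OF x_vertex(3)] by linarith
  hence "connected_in E (vertex 0 (spliced_strand x)) x"
  proof cases
    case path
    hence "r \<le> m" using x_vertex by (simp add: present_0_iff occupied_rho)
    thus ?thesis using path x_vertex connected_path spliced_strand_vertex[OF x_vertex(3)] by simp
  next
    case intact
    hence step: "connected_in E (vertex a w) (vertex (a + 1) w)" for a
      using d_bounds by (intro connected_kept has_next_if_pos) auto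
    show ?thesis
      using intact x_vertex connected_around_cycle[of "- 1" E w r, OF step]
        spliced_strand_vertex[OF x_vertex(3)] by simp
  next
    case spliced
    thus ?thesis using x_vertex connected_spliced spliced_strand_vertex[OF x_vertex(3)] by simp
  qed
  thus ?thesis by (rule equivclp_sym)
qed

lemma spliced_strand_image: "spliced_strand ` G_verts k = {0..f - d}"
proof
  show "spliced_strand ` G_verts k \<subseteq> {0..f - d}"
  proof
    fix c assume "c \<in> spliced_strand ` G_verts k"
    then obtain x where "x \<in> G_verts k" and c_eq: "c = spliced_strand x" by auto
    then obtain r w where "present r w" "x = vertex r w" using vertex_surj by metis
    thus "c \<in> {0..f - d}"
      using c_eq present_nonneg[of r w] d_bounds by (simp add: spliced_strand_vertex)
  qed
  show "{0..f - d} \<subseteq> spliced_strand ` G_verts k"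
  proof
    fix w assume w_bounds: "w \<in> {0..f - d}"
    hence "present 0 w" using present_0_0 present_if_pos[of w 0] d_bounds by (cases "w = 0") auto
    hence "spliced_strand (vertex 0 w) = w" using w_bounds by (simp add: spliced_strand_vertex)
    moreover have "vertex 0 w \<in> G_verts k"
      using w_bounds d_bounds f_le_k vertex_rho_0[of 0 w] unfolding G_verts_def by simp
    ultimately show "w \<in> spliced_strand ` G_verts k" by (metis image_eqI)
  qed
qed

lemma N_shifted: "int (N (eta k q j + d) k) = f - d"
proof -
  have "N (eta k q j + d) k + 1 = card {0..f - d}"
    using N_eq_card_image[OF k_pos spliced_strand_edge connected_strand_origin]
    unfolding spliced_strand_image .
  thus ?thesis using d_bounds by simp
qed

end

context rotation
begin

lemma N_eta_up:
  assumes "0 \<le> d" "d \<le> f"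
  shows "int (N (eta k q j + d) k) = f - d"
proof -
  obtain s where "rho s = (rho m + 1) mod q"
    using rho_surj[of "(rho m + 1) mod q"] q_bounds by auto
  then interpret shifted_rotation k q j s d using assms by unfold_locales
  show ?thesis by (rule N_shifted)
qed

text \<open>The ascending side of the mountain of \<open>j\<close> is the reflection of the descending side of that of
  \<open>- j\<close>.\<close>
lemma N_eta:
  assumes "\<bar>d\<bar> \<le> f"
  shows "int (N (eta k q j + d) k) = f - \<bar>d\<bar>"
proof (cases "0 \<le> d")
  case True
  thus ?thesis using N_eta_up assms by simp
next
  case False
  interpret opposite: rotation k q "- j" by (rule rotation_opposite)
  have "eta k q (- j) + - d = - 2 * k - (eta k q j + d)"
    unfolding eta_opposite by simp
  hence "N (eta k q (- j) + - d) k = N (eta k q j + d) k"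
    by (simp only: N_reflection[OF k_pos])
  thus ?thesis using opposite.N_eta_up[of "- d"] False assms by simp
qed

lemma N_slope:
  assumes "- f \<le> d" "d < f"
  shows "N (eta k q j + d) k < N (eta k q j + d + 1) k \<longleftrightarrow> d < 0"
proof -
  have "int (N (eta k q j + d) k) = f - \<bar>d\<bar>" using assms by (intro N_eta) auto
  moreover have "int (N (eta k q j + d + 1) k) = f - \<bar>d + 1\<bar>"
    unfolding add.assoc using assms by (intro N_eta) auto
  ultimately show ?thesis by linarith
qed

end

section \<open>The cycles at a peak\<close>

context rotation
begin

lemma c_fun_eq_vertex:
  assumes "0 \<le> r" "r \<le> q" "1 \<le> w" "w \<le> f"
  shows "c_fun k q j w r = vertex r w"
proof (cases "r = 0 \<or> r = q")
  case True
  hence "rho r = 0" unfolding rho_def by auto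
  thus ?thesis using True assms f_le_k unfolding c_fun_def by (auto simp: vertex_rho_0)
next
  case False
  have "t_fun k r q j = occupied_below (rho r)"
    unfolding t_fun_def occupied_below_def rho_def[symmetric] by (simp add: Int_def)
  moreover have "0 < rho r" using rho_pos_iff[of r] False assms by simp
  ultimately show ?thesis
    using vertex_rho_pos(1)[OF present_if_pos] False assms
    unfolding c_fun_def start_def rho_def[symmetric] by simp
qed

lemma is_cycle_c_fun:
  assumes w_bounds: "1 \<le> w" "w \<le> f"
  shows "is_cycle (G_edges (eta k q j) k) (c_fun k q j w) q"
  unfolding is_cycle_def
proof (intro conjI ballI)
  fix r assume "r \<in> {0..<q}"
  thus "(c_fun k q j w r, c_fun k q j w (r + 1)) \<in> G_edges (eta k q j) k"
    using w_bounds has_next_if_pos unfolding G_edges_eta by (auto simp: c_fun_eq_vertex)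
next
  show "inj_on (c_fun k q j w) {0..<q}"
  proof (rule inj_onI)
    fix r r' assume r_range: "r \<in> {0..<q}" "r' \<in> {0..<q}" "c_fun k q j w r = c_fun k q j w r'"
    hence "vertex r w = vertex r' w" using w_bounds by (simp add: c_fun_eq_vertex)
    from vertex_inj(1)[OF present_if_pos[OF w_bounds] present_if_pos[OF w_bounds] this]
    show "r = r'" using inj_onD[OF inj_on_rho] r_range by simp
  qed
qed (use q_bounds in \<open>auto simp: c_fun_def\<close>)

lemma cycle_verts_c_fun_distinct:
  assumes w_bounds: "1 \<le> w" "w \<le> f" and w'_bounds: "1 \<le> w'" "w' \<le> f" and w_neq: "w \<noteq> w'"
  shows "cycle_verts (c_fun k q j w) q \<noteq> cycle_verts (c_fun k q j w') q"
proof
  assume "cycle_verts (c_fun k q j w) q = cycle_verts (c_fun k q j w') q"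
  moreover have "c_fun k q j w 0 \<in> cycle_verts (c_fun k q j w) q"
    unfolding cycle_verts_def using q_bounds by auto
  ultimately obtain r where "0 \<le> r" "r < q" "c_fun k q j w 0 = c_fun k q j w' r"
    unfolding cycle_verts_def by auto
  hence "vertex 0 w = vertex r w'"
    using w_bounds w'_bounds q_bounds by (simp add: c_fun_eq_vertex)
  thus False
    using vertex_inj(2)[OF present_if_pos[OF w_bounds] present_if_pos[OF w'_bounds]] w_neq by blast
qed

lemma eta_div: "eta k q j div k = ((k + 1) * j) div q - 1"
proof -
  define b where "b = start (rho (m + 1)) - of_bool (0 < rho (m + 1))"
  have "0 \<le> b \<and> b < k"
  proof (cases "0 < rho (m + 1)")
    case True
    thus ?thesis
      using start_less[OF True] start_rho_le[of "m + 1"] f_pos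
      unfolding b_def by (auto simp: of_bool_def split: if_splits)
  next
    case False
    hence "rho (m + 1) = 0" using rho_nonneg[of "m + 1"] by simp
    thus ?thesis using k_pos unfolding b_def by simp
  qed
  moreover have "eta k q j = b + k * (((k + 1) * j) div q - 1)"
    unfolding eta_eq_start_Suc_m b_def by simp
  ultimately show ?thesis by simp
qed

end

locale farey_index = rotation +
  assumes j_bounds: "1 \<le> j" "j \<le> q"
begin

lemma eta_pos: "0 < eta k q j"
proof -
  have "1 * 1 \<le> f * j" using f_pos j_bounds by (intro mult_mono) auto
  moreover have "0 \<le> (m * j) div q"
    using m_nonneg j_bounds q_bounds by (simp add: pos_imp_zdiv_nonneg_iff)
  ultimately have "1 \<le> turns" unfolding turns_def by simp
  hence "(k + 1) * 1 \<le> (k + 1) * turns" using q_bounds by (intro mult_left_mono) auto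
  hence "0 < (k + 1) * turns - k" by simp
  thus ?thesis unfolding eta_eq_start_m using start_rho_nonneg by (rule add_pos_nonneg)
qed

lemma eta_less: "eta k q j < k\<^sup>2 + k"
proof -
  have "(k + 1) * j \<le> (k + 1) * q" using j_bounds q_bounds by (intro mult_left_mono) auto
  hence "((k + 1) * j) div q \<le> ((k + 1) * q) div q" using q_bounds by (intro zdiv_mono1) auto
  hence "eta k q j div k \<le> k" unfolding eta_div using q_bounds by simp
  hence "k * (eta k q j div k) \<le> k * k" using k_pos by (intro mult_left_mono) auto
  moreover have "eta k q j = k * (eta k q j div k) + eta k q j mod k" by simp
  moreover have "eta k q j mod k < k" using k_pos by simp
  ultimately show ?thesis unfolding power2_eq_square by linarith
qed

lemma local_peak_eta: "local_peak (eta k q j) k"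
  unfolding local_peak_def
  using eta_pos eta_less N_eta[of 0] N_eta[of 1] N_eta[of "- 1"] f_pos by simp

end

lemma farey_index_iff:
  "farey_index k q j \<longleftrightarrow> 1 \<le> q \<and> q \<le> k \<and> 1 \<le> j \<and> j \<le> q \<and> gcd j q = 1"
  unfolding farey_index_def farey_index_axioms_def rotation_def coprime_iff_gcd_eq_1 by auto

section \<open>The mountains tile a period\<close>

lemma cycle_length_le:
  assumes cycle_c: "is_cycle E c l" and cycle_c': "is_cycle E c' l'" and same_start: "c 0 = c' 0"
    and functional: "\<And>x y y'. (x, y) \<in> E \<Longrightarrow> (x, y') \<in> E \<Longrightarrow> y = y'"
  shows "l' \<le> l"
proof (rule ccontr)
  assume "\<not> l' \<le> l"
  hence l_less: "l < l'" by simp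
  have "c r = c' r" if "0 \<le> r" "r \<le> l" for r
    using that
  proof (induction r rule: int_ge_induct)
    case (step r)
    have "(c r, c (r + 1)) \<in> E" "(c' r, c' (r + 1)) \<in> E"
      using cycle_c cycle_c' step.hyps step.prems l_less unfolding is_cycle_def by auto
    moreover have "c r = c' r" using step by simp
    ultimately show ?case using functional by simp
  qed (rule same_start)
  from this[of l] have "c' l = c' 0" "1 \<le> l"
    using cycle_c same_start unfolding is_cycle_def by auto
  moreover have "inj_on c' {0..<l'}" using cycle_c' unfolding is_cycle_def by simp
  ultimately show False using l_less by (auto dest: inj_onD)
qed

lemma eta_inj:
  assumes "farey_index k q j" "farey_index k q' j'" and same_eta: "eta k q j = eta k q' j'"
  shows "q = q' \<and> j = j'"
proof -
  interpret A: farey_index k q j by fact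
  interpret B: farey_index k q' j' by fact
  have "c_fun k q j 1 0 = c_fun k q' j' 1 0" unfolding c_fun_def by simp
  moreover have "is_cycle (G_edges (eta k q j) k) (c_fun k q j 1) q"
    by (rule A.is_cycle_c_fun[OF order_refl A.f_pos])
  moreover have "is_cycle (G_edges (eta k q j) k) (c_fun k q' j' 1) q'"
    unfolding same_eta by (rule B.is_cycle_c_fun[OF order_refl B.f_pos])
  ultimately have q_eq: "q = q'"
    using cycle_length_le G_edges_functional by (metis order_antisym)
  have mono: "((k + 1) * i) div q < ((k + 1) * i') div q" if "i < i'" for i i'
  proof -
    have "(k + 1) * (i + 1) \<le> (k + 1) * i'" using that A.q_bounds by (intro mult_left_mono) auto
    hence "(k + 1) * i + q \<le> (k + 1) * i'" using A.q_bounds by (simp add: algebra_simps)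
    hence "((k + 1) * i + q) div q \<le> ((k + 1) * i') div q"
      using A.q_bounds by (intro zdiv_mono1) auto
    thus ?thesis using A.q_bounds by simp
  qed
  have "((k + 1) * j) div q = ((k + 1) * j') div q"
    using A.eta_div B.eta_div same_eta q_eq by simp
  hence "j = j'" using mono[of j j'] mono[of j' j] by (cases j j' rule: linorder_cases) auto
  with q_eq show ?thesis by simp
qed

definition mountain_points :: "int \<Rightarrow> (int \<times> int \<times> int) set" where
  "mountain_points k = {(q, j, d). farey_index k q j \<and> - fq k q \<le> d \<and> d < fq k q}"

definition mountain_position :: "int \<Rightarrow> int \<times> int \<times> int \<Rightarrow> int" where
  "mountain_position k = (\<lambda>(q, j, d). (eta k q j + d) mod (k\<^sup>2 + k))"

lemma N_add_mod: "N (n mod (k\<^sup>2 + k) + c) k = N (n + c) k"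
  unfolding N_def by (simp add: mod_add_left_eq)

lemma mountain_position_cong:
  assumes "mountain_position k (q, j, d) = mountain_position k (q', j', d')"
  shows "N (eta k q j + d + c) k = N (eta k q' j' + d' + c) k"
  using assms N_add_mod[of "eta k q j + d" k c] N_add_mod[of "eta k q' j' + d'" k c]
  unfolding mountain_position_def by simp

text \<open>If \<open>d < d'\<close>, then walking along both mountains in parallel, one of them would reach its summit
  and change its slope before the other.\<close>
lemma mountain_offset_le:
  assumes point: "(q, j, d) \<in> mountain_points k" and point': "(q', j', d') \<in> mountain_points k"
    and same_position: "mountain_position k (q, j, d) = mountain_position k (q', j', d')"
  shows "d' \<le> d"
proof (rule ccontr)
  interpret A: farey_index k q j using point unfolding mountain_points_def by simp
  interpret B: farey_index k q' j' using point' unfolding mountain_points_def by simp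
  have d_range: "- fq k q \<le> d" "d < fq k q" and d'_range: "- fq k q' \<le> d'" "d' < fq k q'"
    using point point' unfolding mountain_points_def by simp_all
  assume less: "\<not> d' \<le> d"
  have slope: "d + c < 0 \<longleftrightarrow> d' + c < 0"
    if "- fq k q \<le> d + c" "d + c < fq k q" "- fq k q' \<le> d' + c" "d' + c < fq k q'" for c
    using A.N_slope[OF that(1,2)] B.N_slope[OF that(3,4)]
      mountain_position_cong[OF same_position, of c]
      mountain_position_cong[OF same_position, of "c + 1"]
    by (simp add: add.assoc)
  consider (opposite_sides) "d < 0" "0 \<le> d'" | (both_left) "d' < 0" | (both_right) "0 \<le> d"
    using less by linarith
  thus False
  proof cases
    case opposite_sides
    thus ?thesis using slope[of 0] d_range d'_range by simp
  next
    case both_left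
    thus ?thesis using slope[of "- d'"] d_range d'_range less A.f_pos B.f_pos by simp
  next
    case both_right
    thus ?thesis using slope[of "- d - 1"] d_range d'_range less A.f_pos B.f_pos by simp
  qed
qed

lemma mountain_position_inj:
  assumes point: "(q, j, d) \<in> mountain_points k" and point': "(q', j', d') \<in> mountain_points k"
    and same_position: "mountain_position k (q, j, d) = mountain_position k (q', j', d')"
  shows "(q, j, d) = (q', j', d')"
proof -
  interpret A: farey_index k q j using point unfolding mountain_points_def by simp
  interpret B: farey_index k q' j' using point' unfolding mountain_points_def by simp
  have d_eq: "d = d'"
    using mountain_offset_le[OF point point' same_position]
      mountain_offset_le[OF point' point same_position[symmetric]] by simp
  have "(eta k q j + d - d) mod (k\<^sup>2 + k) = (eta k q' j' + d' - d) mod (k\<^sup>2 + k)"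
    using same_position unfolding mountain_position_def prod.case by (rule mod_diff_cong) simp
  hence "eta k q j = eta k q' j'"
    using d_eq A.eta_pos A.eta_less B.eta_pos B.eta_less by simp
  thus ?thesis
    using eta_inj[OF A.farey_index_axioms B.farey_index_axioms] d_eq by simp
qed

lemma inj_on_mountain_position: "inj_on (mountain_position k) (mountain_points k)"
  by (rule inj_onI) (metis prod_cases3 mountain_position_inj)

lemma card_triangle:
  fixes k :: int
  assumes "k \<ge> 0"
  shows "int (card (SIGMA y:{1..k}. {1..y} \<times> (UNIV :: bool set))) = k\<^sup>2 + k"
proof -
  have "int (card (SIGMA y:{1..k}. {1..y} \<times> (UNIV :: bool set))) = (\<Sum>y\<in>{1..k}. y * 2)"
    by (subst card_SigmaI) (auto simp: card_cartesian_product intro!: sum.cong)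
  also have "\<dots> = k\<^sup>2 + k"
    using assms
  proof (induction k rule: int_ge_induct)
    case (step k)
    have "{1..k + 1} = insert (k + 1) {1..k}" using step by auto
    thus ?case using step by (simp add: power2_eq_square algebra_simps)
  qed simp
  finally show ?thesis .
qed

lemma farey_index_reduced:
  fixes k x y :: int
  defines "g \<equiv> gcd x y"
  assumes x_range: "1 \<le> x" "x \<le> y" and y_le_k: "y \<le> k"
  shows "farey_index k (y div g) (x div g)" and "1 \<le> g" and "g \<le> fq k (y div g)"
proof -
  have div_mult_g: "x div g * g = x" "y div g * g = y" unfolding g_def by simp_all
  show g_pos: "1 \<le> g" using x_range unfolding g_def by (simp add: int_one_le_iff_zero_less)
  have quotient_pos: "1 \<le> x div g" "1 \<le> y div g"
    using x_range g_pos zdvd_imp_le[of g x] zdvd_imp_le[of g y] unfolding g_def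
    by (simp_all add: pos_imp_zdiv_pos_iff int_one_le_iff_zero_less)
  have "x div g \<le> y div g" using x_range g_pos by (intro zdiv_mono1) auto
  moreover have "y div g \<le> k"
    using mult_left_mono[OF g_pos, of "y div g"] quotient_pos div_mult_g y_le_k by simp
  moreover have "coprime (x div g) (y div g)"
    unfolding g_def using x_range by (intro div_gcd_coprime) auto
  ultimately show "farey_index k (y div g) (x div g)"
    using quotient_pos by unfold_locales
  have "y div g * g div (y div g) \<le> k div (y div g)"
    unfolding div_mult_g using y_le_k quotient_pos by (intro zdiv_mono1) auto
  thus "g \<le> fq k (y div g)" unfolding fq_def using quotient_pos by simp
qed

lemma mountain_position_range:
  assumes "k \<ge> 1"
  shows "mountain_position k ` mountain_points k \<subseteq> {0..<k\<^sup>2 + k}"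
proof -
  have "k\<^sup>2 + k > 0" using assms by (simp add: add_nonneg_pos)
  thus ?thesis unfolding mountain_position_def by auto
qed

text \<open>A pair \<open>x \<le> y \<le> k\<close> is \<open>g\<close> times a coprime pair \<open>(j, q)\<close> with \<open>1 \<le> g \<le> \<lfloor>k / q\<rfloor>\<close>; it accounts
  for the offsets \<open>g - 1\<close> and \<open>- g\<close>.\<close>
lemma card_mountain_points_ge:
  assumes "k \<ge> 1"
  shows "k\<^sup>2 + k \<le> int (card (mountain_points k))"
proof -
  define T where "T = (SIGMA y:{1..k}. {1..y} \<times> (UNIV :: bool set))"
  define scale :: "int \<Rightarrow> int" where "scale d = (if 0 \<le> d then d + 1 else - d)" for d
  define multiple where "multiple = (\<lambda>(q, j, d). (q * scale d, j * scale d, 0 \<le> d))"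
  define reduce where "reduce = (\<lambda>(y, x, b).
    (y div gcd x y, x div gcd x y, if b then gcd x y - 1 else - gcd x y :: int))"
  have reduce: "reduce p \<in> mountain_points k" "multiple (reduce p) = p" if "p \<in> T" for p
  proof -
    obtain y x b where p_eq: "p = (y, x, b)" by (cases p)
    hence "1 \<le> x" "x \<le> y" "y \<le> k" using that unfolding T_def by auto
    note reduced = farey_index_reduced[OF this]
    show "reduce p \<in> mountain_points k"
      using reduced unfolding p_eq reduce_def mountain_points_def by auto
    show "multiple (reduce p) = p"
      using reduced(2) unfolding p_eq reduce_def multiple_def scale_def by auto
  qed
  have "finite (mountain_points k)"
    using inj_on_finite[OF inj_on_mountain_position mountain_position_range[OF assms]] by simp
  moreover have "inj_on reduce T" using reduce(2) by (rule inj_on_inverseI)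
  ultimately have "card T \<le> card (mountain_points k)"
    using reduce(1) by (intro card_inj_on_le) auto
  moreover have "int (card T) = k\<^sup>2 + k"
    unfolding T_def using assms by (intro card_triangle) simp
  ultimately show ?thesis by linarith
qed

theorem mountain_position_bij:
  assumes "k \<ge> 1"
  shows "bij_betw (mountain_position k) (mountain_points k) {0..<k\<^sup>2 + k}"
proof (rule bij_betw_imageI[OF inj_on_mountain_position card_seteq])
  show "card {0..<k\<^sup>2 + k} \<le> card (mountain_position k ` mountain_points k)"
    using card_image[OF inj_on_mountain_position, of k] card_mountain_points_ge[OF assms] by simp
qed (simp, rule mountain_position_range[OF assms])

lemma local_peak_iff_eta:
  assumes k_pos: "k \<ge> 1"
  shows "local_peak n k \<longleftrightarrow> (\<exists>q j. farey_index k q j \<and> n = eta k q j)"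
proof
  assume "local_peak n k"
  hence peak_at_n: "0 < n" "n < k\<^sup>2 + k" "N (n - 1) k < N n k" "N (n + 1) k < N n k"
    unfolding local_peak_def by auto
  hence "n \<in> mountain_position k ` mountain_points k"
    using bij_betw_imp_surj_on[OF mountain_position_bij[OF k_pos]] by simp
  then obtain q j d where index: "farey_index k q j" and d_range: "- fq k q \<le> d" "d < fq k q"
    and n_eq: "n = (eta k q j + d) mod (k\<^sup>2 + k)"
    unfolding mountain_points_def mountain_position_def by auto
  interpret farey_index k q j by fact
  have cong: "N (n + c) k = N (eta k q j + d + c) k" for c
    unfolding n_eq by (rule N_add_mod)
  have "d = 0"
  proof (rule linorder_cases[of d 0])
    assume "d < 0"
    thus ?thesis using N_slope[OF d_range] cong[of 0] cong[of 1] peak_at_n by simp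
  next
    assume "d > 0"
    thus ?thesis
      using N_slope[of "d - 1"] d_range f_pos cong[of 0] cong[of "- 1"] peak_at_n
      by (simp add: add_diff_eq)
  qed
  hence "n = eta k q j" using n_eq eta_pos eta_less by simp
  thus "\<exists>q j. farey_index k q j \<and> n = eta k q j" using index by blast
qed (use farey_index.local_peak_eta in blast)

theorem theorem7p5:
  fixes k :: int
  assumes "k \<ge> 1"
  shows "(\<forall>q j. 1 \<le> q \<and> q \<le> k \<and> 1 \<le> j \<and> j \<le> q \<and> gcd j q = 1 \<longrightarrow>
            (\<forall>w \<in> {1..fq k q}. is_cycle (G_edges (eta k q j) k) (c_fun k q j w) q) \<and>
            (\<forall>w \<in> {1..fq k q}. \<forall>w' \<in> {1..fq k q}. w \<noteq> w' \<longrightarrow>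
               cycle_verts (c_fun k q j w) q \<noteq> cycle_verts (c_fun k q j w') q) \<and>
            int (N (eta k q j) k) = fq k q \<and>
            local_peak (eta k q j) k)
       \<and> {n. local_peak n k} =
           {eta k q j | q j. 1 \<le> q \<and> q \<le> k \<and> 1 \<le> j \<and> j \<le> q \<and> gcd j q = 1}
       \<and> {(n, int (N n k)) | n. local_peak n k} =
           {(eta k q j, k div q) | q j. 1 \<le> q \<and> q \<le> k \<and> 1 \<le> j \<and> j \<le> q \<and> gcd j q = 1}"
proof -
  have at_peak: "(\<forall>w \<in> {1..fq k q}. is_cycle (G_edges (eta k q j) k) (c_fun k q j w) q) \<and>
      (\<forall>w \<in> {1..fq k q}. \<forall>w' \<in> {1..fq k q}. w \<noteq> w' \<longrightarrow>
         cycle_verts (c_fun k q j w) q \<noteq> cycle_verts (c_fun k q j w') q) \<and>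
      int (N (eta k q j) k) = fq k q \<and> local_peak (eta k q j) k" if "farey_index k q j" for q j
  proof -
    interpret farey_index k q j by fact
    show ?thesis
      using is_cycle_c_fun cycle_verts_c_fun_distinct N_eta[of 0] f_pos local_peak_eta by simp
  qed
  moreover have "{n. local_peak n k} = {eta k q j | q j. farey_index k q j}"
    unfolding local_peak_iff_eta[OF assms] by auto
  moreover have "{(n, int (N n k)) | n. local_peak n k} =
      {(eta k q j, k div q) | q j. farey_index k q j}"
    unfolding local_peak_iff_eta[OF assms] using at_peak fq_def by (auto, blast)
  ultimately show ?thesis unfolding farey_index_iff by blast
qed

end
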